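(* Let $\boldsymbol k\in\mathbb R^d$ and $\omega\in\mathbb R\setminus\{0\}$ be such that $\omega^2\neq\tilde\lambda_m$ for all $m\ge1$ and $\langle\tilde w\rangle\neq0$. Then the Willis effective constitutive parameters $\tilde{\boldsymbol C}^e,\tilde\rho^e,\tilde{\boldsymbol S}^{e1},\tilde{\boldsymbol S}^{e2}$ (defined in the context) carry the symmetries $$\tilde\rho^e=\tilde\rho^{e*},\qquad \tilde{\boldsymbol C}^e=\tilde{\boldsymbol C}^{e*},\qquad \tilde{\boldsymbol S}^{e1}=-\tilde{\boldsymbol S}^{e2*},$$ and admit the representation $$\tilde\rho^e=-\omega^2\tilde Z^e|\langle\rho\tilde w\rangle|^2+i\boldsymbol k\cdot\langle\rho\tilde{\boldsymbol v}\rangle,$$ $$\tilde{\boldsymbol C}^e=\langle G\rangle\boldsymbol I+\tilde Z^e\,\overline{\langle\tilde{\boldsymbol v}\rangle}\otimes\langle\tilde{\boldsymbol v}\rangle-\langle G\nabla_{\boldsymbol k}\tilde{\boldsymbol v}\rangle,$$ $$\tilde{\boldsymbol S}^{e2}=i\omega\big(\langle\rho\tilde{\boldsymbol v}\rangle-\tilde Z^e\langle\rho\tilde w\rangle\langle\tilde{\boldsymbol v}\rangle\big),$$ where $\tilde Z^e=1/\langle\tilde w\rangle$ and $\tilde w,\tilde{\boldsymbol v}$ are given, in the $L^2_\rho(Y)$ sense, by $$\tilde w=\sum_{m=1}^\infty\frac{(1,\tilde\phi_m)}{\tilde\lambda_m-\omega^2}\,\tilde\phi_m,\qquad \tilde{\boldsymbol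 v}=\sum_{m=1}^\infty\frac{(G,\nabla_{\boldsymbol k}\tilde\phi_m)}{\tilde\lambda_m-\omega^2}\,\tilde\phi_m .$$
   Context: **Setting.** $d\in\{1,2,3\}$, $Y=\{\boldsymbol x\in\mathbb R^d:0<x_j<\ell_j\}$; $G,\rho$ are real-valued, $Y$-periodic, in $L^\infty(Y)$ and bounded below by a positive constant. $\langle g\rangle=|Y|^{-1}\int_Yg$; $(f,g)=\int_Y f\,\overline g\,d\boldsymbol x$, so $(1,\tilde\phi)=\int_Y\overline{\tilde\phi}$ and $(G,\nabla_{\boldsymbol k}\tilde\phi)=\int_YG\,\overline{\nabla_{\boldsymbol k}\tilde\phi}$ (a vector). $L^2_\rho(Y)$ is the $L^2$ space with weight $\rho$. $H^1_p(Y)$ is the space of $g\in L^2(Y)$ with $\nabla g\in L^2(Y)^d$ and $g|_{x_j=0}=g|_{x_j=\ell_j}$, $j=1,\dots,d$. $\nabla_{\boldsymbol k}=\nabla+i\boldsymbol k$; for a vector field $\boldsymbol g$, $(\nabla_{\boldsymbol k}\boldsymbol g)_{ij}=\partial_ig_j+ik_ig_j$, and $\nabla_{\boldsymbol k}\cdot$ contracts with the first index. Dots and $\otimes$ involve no conjugation; $(\cdot)^*$ is the conjugate transpose (the complex conjugate for scalars and the componentwise complex conjugate for vectors). $\boldsymbol I$ is the identity tensor. **Cell functions.** $\tilde w\in H^1_p(Y)$ and $\tilde{\boldsymbol v}\in H^1_p(Y)^d$ are the solutions, with periodic fluxes $G\nabla_{\boldsymbol k}\tilde w$ and $G(\nabla_{\boldsymbol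 k}\tilde{\boldsymbol v}-\boldsymbol I)$ (i.e. weakly against all test functions in $H^1_p(Y)$), of $$-\omega^2\rho\tilde w-\nabla_{\boldsymbol k}\cdot(G\nabla_{\boldsymbol k}\tilde w)=1,\qquad -\omega^2\rho\tilde{\boldsymbol v}-\nabla_{\boldsymbol k}\cdot\big(G(\nabla_{\boldsymbol k}\tilde{\boldsymbol v}-\boldsymbol I)\big)=\boldsymbol0\quad\text{in }Y.$$ **Eigensystem.** $\{\tilde\phi_m,\tilde\lambda_m\}_{m\ge1}$, $\tilde\phi_m\in H^1_p(Y)$, $\tilde\lambda_m\in\mathbb R$, solves $-\nabla_{\boldsymbol k}\cdot(G\nabla_{\boldsymbol k}\tilde\phi_m)=\tilde\lambda_m\rho\tilde\phi_m$ in $Y$ with periodic flux, where $\{\tilde\phi_m\}$ is complete in $L^2_\rho(Y)$ and orthonormal: $\int_Y\rho\,\tilde\phi_m\overline{\tilde\phi_n}=\delta_{mn}$. **Effective parameters.** With $$\tilde{\boldsymbol A}=\frac{\langle\tilde{\boldsymbol v}\rangle}{\langle\tilde w\rangle}\tilde w-\tilde{\boldsymbol v},\qquad \tilde B=\frac1{i\omega}\Big(1-\frac{\tilde w}{\langle\tilde w\rangle}\Big)+\frac1{i\omega}\Big(\frac{i\boldsymbol k\cdot\langle\tilde{\boldsymbol v}\rangle}{\langle\tilde w\rangle}\tilde w-i\boldsymbol k\cdot\tilde{\boldsymbol v}\Big),$$ the Willis effective constitutive parameters are $$\tilde{\boldsymbol C}^e=\langle G(\nabla_{\boldsymbol k}\tilde{\boldsymbol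 A}+\boldsymbol I)\rangle,\quad \tilde{\boldsymbol S}^{e1}=\langle G\nabla_{\boldsymbol k}\tilde B\rangle,\quad \tilde{\boldsymbol S}^{e2}=\langle-i\omega\rho\tilde{\boldsymbol A}\rangle,\quad \tilde\rho^e=\langle\rho-i\omega\rho\tilde B\rangle.$$ *)

theory Defs
  imports "HOL-Analysis.Analysis"
begin

text \<open>
  Points of \<open>\<real>\<^sup>d\<close> have type \<open>real ^ 'n\<close> with \<open>d = CARD('n)\<close>; the vector \<open>l\<close> collects the edge
  lengths of the cell. Elements of Lebesgue and Sobolev spaces are represented by functions;
  only their values almost everywhere on the cell matter.
\<close>

definition cell :: "real ^ 'n \<Rightarrow> (real ^ 'n) set" where
  "cell l = {x. \<forall>j. 0 < x $ j \<and> x $ j < l $ j}"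

definition avg :: "real ^ 'n \<Rightarrow> (real ^ 'n \<Rightarrow> 'b) \<Rightarrow> 'b::{banach, second_countable_topology}" where
  "avg l g = (1 / measure lebesgue (cell l)) *\<^sub>R (LINT x|lebesgue_on (cell l). g x)"

definition admissible_coefficient :: "real ^ 'n \<Rightarrow> (real ^ 'n \<Rightarrow> real) \<Rightarrow> bool" where
  "admissible_coefficient l g \<longleftrightarrow>
     (AE x in lebesgue. \<forall>j. g (x + axis j (l $ j)) = g x) \<and>
     g \<in> borel_measurable (lebesgue_on (cell l)) \<and>
     (\<exists>M. AE x in lebesgue_on (cell l). \<bar>g x\<bar> \<le> M) \<and>
     (\<exists>c>0. AE x in lebesgue_on (cell l). c \<le> g x)"


subsection \<open>Vectors and tensors\<close>

text \<open>The dot and tensor products are bilinear: no conjugation.\<close>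

definition cdot :: "complex ^ 'n \<Rightarrow> complex ^ 'n \<Rightarrow> complex" where
  "cdot a b = (\<Sum>j\<in>UNIV. a $ j * b $ j)"

definition outer :: "complex ^ 'n \<Rightarrow> complex ^ 'n \<Rightarrow> complex ^ 'n ^ 'n" where
  "outer a b = (\<chi> i j. a $ i * b $ j)"

definition vcnj :: "complex ^ 'n \<Rightarrow> complex ^ 'n" where
  "vcnj a = (\<chi> j. cnj (a $ j))"

definition conj_transpose :: "complex ^ 'n ^ 'n \<Rightarrow> complex ^ 'n ^ 'n" where
  "conj_transpose M = (\<chi> i j. cnj (M $ j $ i))"

definition cvec :: "real ^ 'n \<Rightarrow> complex ^ 'n" where
  "cvec k = (\<chi> j. complex_of_real (k $ j))"


subsection \<open>Lebesgue spaces on the cell\<close>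

definition L2_weighted ::
  "real ^ 'n \<Rightarrow> (real ^ 'n \<Rightarrow> real) \<Rightarrow> (real ^ 'n \<Rightarrow> 'b::real_normed_vector) \<Rightarrow> bool" where
  "L2_weighted l \<rho> f \<longleftrightarrow>
     f \<in> borel_measurable (lebesgue_on (cell l)) \<and>
     integrable (lebesgue_on (cell l)) (\<lambda>x. \<rho> x * (norm (f x))\<^sup>2)"

abbreviation L2 :: "real ^ 'n \<Rightarrow> (real ^ 'n \<Rightarrow> 'b::real_normed_vector) \<Rightarrow> bool" where
  "L2 l \<equiv> L2_weighted l (\<lambda>x. 1)"

definition converges_L2_weighted ::
  "real ^ 'n \<Rightarrow> (real ^ 'n \<Rightarrow> real) \<Rightarrow> (nat \<Rightarrow> real ^ 'n \<Rightarrow> 'b::real_normed_vector) \<Rightarrow>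
   (real ^ 'n \<Rightarrow> 'b) \<Rightarrow> bool" where
  "converges_L2_weighted l \<rho> F f \<longleftrightarrow>
     (\<forall>N. L2_weighted l \<rho> (\<lambda>x. F N x - f x)) \<and>
     (\<lambda>N. LINT x|lebesgue_on (cell l). \<rho> x * (norm (F N x - f x))\<^sup>2) \<longlonglongrightarrow> 0"

abbreviation converges_L2 ::
  "real ^ 'n \<Rightarrow> (nat \<Rightarrow> real ^ 'n \<Rightarrow> 'b::real_normed_vector) \<Rightarrow> (real ^ 'n \<Rightarrow> 'b) \<Rightarrow> bool" where
  "converges_L2 l \<equiv> converges_L2_weighted l (\<lambda>x. 1)"


subsection \<open>Smooth functions and weak gradients\<close>

definition partial_deriv :: "'n \<Rightarrow> (real ^ 'n \<Rightarrow> complex) \<Rightarrow> real ^ 'n \<Rightarrow> complex" where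
  "partial_deriv j f x = frechet_derivative f (at x) (axis j 1)"

definition classical_grad :: "(real ^ 'n \<Rightarrow> complex) \<Rightarrow> real ^ 'n \<Rightarrow> complex ^ 'n" where
  "classical_grad f x = (\<chi> j. partial_deriv j f x)"

fun Ck :: "nat \<Rightarrow> (real ^ 'n \<Rightarrow> complex) \<Rightarrow> bool" where
  "Ck 0 f \<longleftrightarrow> continuous_on UNIV f"
| "Ck (Suc m) f \<longleftrightarrow> (\<forall>x. f differentiable (at x)) \<and> (\<forall>j. Ck m (partial_deriv j f))"

definition smooth :: "(real ^ 'n \<Rightarrow> complex) \<Rightarrow> bool" where
  "smooth f \<longleftrightarrow> (\<forall>m. Ck m f)"

definition test_function :: "real ^ 'n \<Rightarrow> (real ^ 'n \<Rightarrow> complex) \<Rightarrow> bool" where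
  "test_function l \<phi> \<longleftrightarrow>
     smooth \<phi> \<and> compact (closure {x. \<phi> x \<noteq> 0}) \<and> closure {x. \<phi> x \<noteq> 0} \<subseteq> cell l"

definition is_weak_grad ::
  "real ^ 'n \<Rightarrow> (real ^ 'n \<Rightarrow> complex) \<Rightarrow> (real ^ 'n \<Rightarrow> complex ^ 'n) \<Rightarrow> bool" where
  "is_weak_grad l g h \<longleftrightarrow>
     (\<forall>\<phi> j. test_function l \<phi> \<longrightarrow>
        (LINT x|lebesgue_on (cell l). g x * partial_deriv j \<phi> x) =
        - (LINT x|lebesgue_on (cell l). h x $ j * \<phi> x))"

definition H1 :: "real ^ 'n \<Rightarrow> (real ^ 'n \<Rightarrow> complex) \<Rightarrow> bool" where
  "H1 l g \<longleftrightarrow> L2 l g \<and> (\<exists>h. L2 l h \<and> is_weak_grad l g h)"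

text \<open>The weak gradient of an \<open>H1\<close> function is unique up to null sets of the cell.\<close>

definition grad :: "real ^ 'n \<Rightarrow> (real ^ 'n \<Rightarrow> complex) \<Rightarrow> real ^ 'n \<Rightarrow> complex ^ 'n" where
  "grad l g = (SOME h. L2 l h \<and> is_weak_grad l g h)"


subsection \<open>Traces and the periodic Sobolev space\<close>

definition face_proj :: "'n \<Rightarrow> real \<Rightarrow> real ^ 'n \<Rightarrow> real ^ 'n" where
  "face_proj j a x = (\<chi> i. if i = j then a else x $ i)"

text \<open>
  \<open>face_trace l j a g \<tau>\<close>: the trace of \<open>g\<close> on the face \<open>x\<^sub>j = a\<close> (with \<open>a = 0\<close> or \<open>a = l $ j\<close>)
  is \<open>\<tau>\<close>, defined as usual by density of functions smooth up to the boundary in \<open>H\<^sup>1\<close>. A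
  function on the face is encoded as the function on the cell that does not depend on \<open>x\<^sub>j\<close>:
  integrating the latter over the cell gives \<open>l $ j\<close> times the surface integral over the face.
  Thus traces on opposite faces are equal iff they have a common encoding \<open>\<tau>\<close>.
\<close>

definition face_trace ::
  "real ^ 'n \<Rightarrow> 'n \<Rightarrow> real \<Rightarrow> (real ^ 'n \<Rightarrow> complex) \<Rightarrow> (real ^ 'n \<Rightarrow> complex) \<Rightarrow> bool" where
  "face_trace l j a g \<tau> \<longleftrightarrow>
     (\<exists>u. (\<forall>n. smooth (u n)) \<and>
          converges_L2 l u g \<and>
          converges_L2 l (\<lambda>n. classical_grad (u n)) (grad l g) \<and>
          converges_L2 l (\<lambda>n x. u n (face_proj j a x)) \<tau>)"

definition H1_per :: "real ^ 'n \<Rightarrow> (real ^ 'n \<Rightarrow> complex) \<Rightarrow> bool" where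
  "H1_per l g \<longleftrightarrow>
     H1 l g \<and> (\<forall>j. \<exists>\<tau>. face_trace l j 0 g \<tau> \<and> face_trace l j (l $ j) g \<tau>)"


subsection \<open>The operator \<open>\<nabla> + i k\<close> and weak equations\<close>

definition kgrad ::
  "real ^ 'n \<Rightarrow> real ^ 'n \<Rightarrow> (real ^ 'n \<Rightarrow> complex) \<Rightarrow> real ^ 'n \<Rightarrow> complex ^ 'n" where
  "kgrad l k g x = grad l g x + (\<chi> i. \<i> * complex_of_real (k $ i) * g x)"

definition kgrad_vec ::
  "real ^ 'n \<Rightarrow> real ^ 'n \<Rightarrow> (real ^ 'n \<Rightarrow> complex ^ 'n) \<Rightarrow> real ^ 'n \<Rightarrow> complex ^ 'n ^ 'n" where
  "kgrad_vec l k g x = (\<chi> i j. kgrad l k (\<lambda>y. g y $ j) x $ i)"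

text \<open>
  Weak form of \<open>s - (\<nabla> + i k) \<cdot> F = f\<close> in the cell with periodic flux \<open>F\<close>: multiply by \<open>cnj \<psi>\<close>
  and integrate by parts, the boundary terms cancelling by periodicity.
\<close>

definition weak_eq ::
  "real ^ 'n \<Rightarrow> real ^ 'n \<Rightarrow> (real ^ 'n \<Rightarrow> complex) \<Rightarrow> (real ^ 'n \<Rightarrow> complex ^ 'n) \<Rightarrow>
   (real ^ 'n \<Rightarrow> complex) \<Rightarrow> bool" where
  "weak_eq l k s F f \<longleftrightarrow>
     (\<forall>\<psi>. H1_per l \<psi> \<longrightarrow>
        (LINT x|lebesgue_on (cell l). s x * cnj (\<psi> x)) +
        (LINT x|lebesgue_on (cell l). cdot (F x) (vcnj (kgrad l k \<psi> x))) =
        (LINT x|lebesgue_on (cell l). f x * cnj (\<psi> x)))"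

definition cell_solution_w ::
  "real ^ 'n \<Rightarrow> real ^ 'n \<Rightarrow> real \<Rightarrow> (real ^ 'n \<Rightarrow> real) \<Rightarrow> (real ^ 'n \<Rightarrow> real) \<Rightarrow>
   (real ^ 'n \<Rightarrow> complex) \<Rightarrow> bool" where
  "cell_solution_w l k \<omega> G \<rho> w \<longleftrightarrow>
     H1_per l w \<and>
     weak_eq l k (\<lambda>x. - complex_of_real (\<omega>\<^sup>2 * \<rho> x) * w x) (\<lambda>x. G x *\<^sub>R kgrad l k w x) (\<lambda>x. 1)"

text \<open>
  The divergence contracts the first index, so the \<open>j\<close>-th component of the equation for \<open>v\<close>
  involves the \<open>j\<close>-th column of the flux.
\<close>

definition cell_solution_v ::
  "real ^ 'n \<Rightarrow> real ^ 'n \<Rightarrow> real \<Rightarrow> (real ^ 'n \<Rightarrow> real) \<Rightarrow> (real ^ 'n \<Rightarrow> real) \<Rightarrow>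
   (real ^ 'n \<Rightarrow> complex ^ 'n) \<Rightarrow> bool" where
  "cell_solution_v l k \<omega> G \<rho> v \<longleftrightarrow>
     (\<forall>j. H1_per l (\<lambda>x. v x $ j)) \<and>
     (\<forall>j. weak_eq l k (\<lambda>x. - complex_of_real (\<omega>\<^sup>2 * \<rho> x) * v x $ j)
                      (\<lambda>x. column j (G x *\<^sub>R (kgrad_vec l k v x - mat 1)))
                      (\<lambda>x. 0))"

text \<open>
  Eigenpairs are indexed by \<open>m \<ge> 1\<close>. Completeness: finite linear combinations of the
  eigenfunctions are dense in the weighted \<open>L\<^sup>2\<close> space.
\<close>

definition eigensystem ::
  "real ^ 'n \<Rightarrow> real ^ 'n \<Rightarrow> (real ^ 'n \<Rightarrow> real) \<Rightarrow> (real ^ 'n \<Rightarrow> real) \<Rightarrow>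
   (nat \<Rightarrow> real ^ 'n \<Rightarrow> complex) \<Rightarrow> (nat \<Rightarrow> real) \<Rightarrow> bool" where
  "eigensystem l k G \<rho> \<phi> ev \<longleftrightarrow>
     (\<forall>m\<ge>1. H1_per l (\<phi> m) \<and>
        weak_eq l k (\<lambda>x. 0) (\<lambda>x. G x *\<^sub>R kgrad l k (\<phi> m) x)
                    (\<lambda>x. complex_of_real (ev m * \<rho> x) * \<phi> m x)) \<and>
     (\<forall>m\<ge>1. \<forall>n\<ge>1.
        (LINT x|lebesgue_on (cell l). complex_of_real (\<rho> x) * \<phi> m x * cnj (\<phi> n x)) =
        (if m = n then 1 else 0)) \<and>
     (\<forall>f :: real ^ 'n \<Rightarrow> complex. L2_weighted l \<rho> f \<longrightarrow>
        (\<forall>\<epsilon>>0. \<exists>N c. (LINT x|lebesgue_on (cell l).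
            \<rho> x * (norm (f x - (\<Sum>m = 1..N. c m * \<phi> m x)))\<^sup>2) < \<epsilon>))"


subsection \<open>Willis effective parameters\<close>

definition A_cell ::
  "real ^ 'n \<Rightarrow> (real ^ 'n \<Rightarrow> complex) \<Rightarrow> (real ^ 'n \<Rightarrow> complex ^ 'n) \<Rightarrow> real ^ 'n \<Rightarrow> complex ^ 'n" where
  "A_cell l w v x = w x *s ((1 / avg l w) *s avg l v) - v x"

definition B_cell ::
  "real ^ 'n \<Rightarrow> real ^ 'n \<Rightarrow> real \<Rightarrow> (real ^ 'n \<Rightarrow> complex) \<Rightarrow> (real ^ 'n \<Rightarrow> complex ^ 'n) \<Rightarrow>
   real ^ 'n \<Rightarrow> complex" where
  "B_cell l k \<omega> w v x =
     1 / (\<i> * complex_of_real \<omega>) * (1 - w x / avg l w) +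
     1 / (\<i> * complex_of_real \<omega>) *
       (\<i> * cdot (cvec k) (avg l v) / avg l w * w x - \<i> * cdot (cvec k) (v x))"

definition C_eff ::
  "real ^ 'n \<Rightarrow> real ^ 'n \<Rightarrow> (real ^ 'n \<Rightarrow> real) \<Rightarrow> (real ^ 'n \<Rightarrow> complex) \<Rightarrow>
   (real ^ 'n \<Rightarrow> complex ^ 'n) \<Rightarrow> complex ^ 'n ^ 'n" where
  "C_eff l k G w v = avg l (\<lambda>x. G x *\<^sub>R (kgrad_vec l k (A_cell l w v) x + mat 1))"

definition S1_eff ::
  "real ^ 'n \<Rightarrow> real ^ 'n \<Rightarrow> real \<Rightarrow> (real ^ 'n \<Rightarrow> real) \<Rightarrow> (real ^ 'n \<Rightarrow> complex) \<Rightarrow>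
   (real ^ 'n \<Rightarrow> complex ^ 'n) \<Rightarrow> complex ^ 'n" where
  "S1_eff l k \<omega> G w v = avg l (\<lambda>x. G x *\<^sub>R kgrad l k (B_cell l k \<omega> w v) x)"

definition S2_eff ::
  "real ^ 'n \<Rightarrow> real \<Rightarrow> (real ^ 'n \<Rightarrow> real) \<Rightarrow> (real ^ 'n \<Rightarrow> complex) \<Rightarrow>
   (real ^ 'n \<Rightarrow> complex ^ 'n) \<Rightarrow> complex ^ 'n" where
  "S2_eff l \<omega> \<rho> w v =
     avg l (\<lambda>x. (- \<i> * complex_of_real \<omega> * complex_of_real (\<rho> x)) *s A_cell l w v x)"

definition rho_eff ::
  "real ^ 'n \<Rightarrow> real ^ 'n \<Rightarrow> real \<Rightarrow> (real ^ 'n \<Rightarrow> real) \<Rightarrow> (real ^ 'n \<Rightarrow> complex) \<Rightarrow>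
   (real ^ 'n \<Rightarrow> complex ^ 'n) \<Rightarrow> complex" where
  "rho_eff l k \<omega> \<rho> w v =
     avg l (\<lambda>x. complex_of_real (\<rho> x)
                - \<i> * complex_of_real \<omega> * complex_of_real (\<rho> x) * B_cell l k \<omega> w v x)"

definition Z_eff :: "real ^ 'n \<Rightarrow> (real ^ 'n \<Rightarrow> complex) \<Rightarrow> complex" where
  "Z_eff l w = 1 / avg l w"

end

(*
  Both cell problems are Galerkin identities for one sesquilinear form
    form f g = < - omega^2 rho f cnj g + G kgrad f . cnj (kgrad g) >,
  which is Hermitian because G, rho, omega are real. Testing the two problems against w and the
  components of v, and exchanging the arguments, shows that <w> is real, that <G kgrad w> is the
  conjugate of <v>, and that <G kgrad v> is Hermitian. Testing against the constant 1, whose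
  kgrad is i k, gives two balance laws for <rho w> and <rho v>; substituting them
  into the definitions of the effective parameters gives the formulas. Testing against an
  eigenfunction gives the Fourier coefficients of w and v.

  The analytic input is that the weak gradient is unique almost everywhere, which makes the
  chosen representative linear, and that 1 is an admissible test function.
*)
theory Submission
  imports Defs
begin

subsection \<open>Smooth bump functions\<close>

text \<open>\<open>grad\<close> picks some representative of the weak gradient, so even
  \<open>kgrad\<close> of a sum is known only almost everywhere, and the fields
  \<open>A_cell\<close> and \<open>B_cell\<close> come with choices of their own. Comparing these
  choices takes the fundamental lemma of the calculus of variations, hence test functions rich
  enough to recover indicators of boxes; they are built from \<open>exp (- 1 / s)\<close>. The
  constant 1 has gradient zero because derivatives of test functions integrate to zero.

  The squared modulus in the density comes from the balance law for \<open>w\<close>: since <G kgrad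
  w> is the conjugate of <v>, this law says that i k . <v> - 1 is omega^2 times the conjugate of
  <rho w>. That i k . <rho v> is real comes from the balance law for \<open>v\<close>, which writes
  it through the quadratic form of the Hermitian matrix <G kgrad v> at the real vector k.

  Knowing the Fourier coefficients does not yet give convergence of the series. Completeness is
  phrased as density of finite combinations, and best approximation by orthogonal projection turns
  it into convergence of the partial sums.\<close>

lemma partial_deriv_eq:
  "(f has_derivative D) (at x) \<Longrightarrow> partial_deriv j f x = D (axis j 1)"
  unfolding partial_deriv_def using frechet_derivative_at by metis

lemma partial_deriv_const [simp]: "partial_deriv j (\<lambda>x. c) = (\<lambda>x. 0)"
  by (rule ext, rule partial_deriv_eq[of _ "\<lambda>_. 0"]) simp

lemma partial_deriv_add:
  assumes "\<And>x. f differentiable at x" "\<And>x. g differentiable at x"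
  shows "partial_deriv j (\<lambda>x. f x + g x) = (\<lambda>x. partial_deriv j f x + partial_deriv j g x)"
proof
  fix x
  obtain D E where "(f has_derivative D) (at x)" "(g has_derivative E) (at x)"
    using assms unfolding differentiable_def by blast
  then show "partial_deriv j (\<lambda>x. f x + g x) x = partial_deriv j f x + partial_deriv j g x"
    by (simp add: partial_deriv_eq[OF has_derivative_add] partial_deriv_eq)
qed

lemma partial_deriv_mult:
  assumes "\<And>x. f differentiable at x" "\<And>x. g differentiable at x"
  shows "partial_deriv j (\<lambda>x. f x * g x)
    = (\<lambda>x. f x * partial_deriv j g x + partial_deriv j f x * g x)"
proof
  fix x
  obtain D E where "(f has_derivative D) (at x)" "(g has_derivative E) (at x)"
    using assms unfolding differentiable_def by blast
  then show "partial_deriv j (\<lambda>x. f x * g x) x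
      = f x * partial_deriv j g x + partial_deriv j f x * g x"
    by (simp add: partial_deriv_eq[OF has_derivative_mult] partial_deriv_eq)
qed

text \<open>The product rule leaves undifferentiated factors behind, and the induction in
  \<open>Ck_mult\<close> needs these at the lower order. Only the base case has content:
  \<open>Ck\<close> asks for continuity at the last order alone, so below it continuity has to come
  from differentiability.\<close>

lemma Ck_SucD: "Ck (Suc m) f \<Longrightarrow> Ck m f"
proof (induction m arbitrary: f)
  case 0
  then show ?case
    by (simp add: continuous_on_eq_continuous_within differentiable_imp_continuous_within)
next
  case (Suc m)
  then show ?case using Ck.simps(2) by blast
qed

lemma Ck_const: "Ck m (\<lambda>x. c)"
  by (induction m arbitrary: c) auto

lemma Ck_add: "Ck m f \<Longrightarrow> Ck m g \<Longrightarrow> Ck m (\<lambda>x. f x + g x)"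
  by (induction m arbitrary: f g) (auto intro: continuous_on_add simp: partial_deriv_add)

lemma Ck_mult: "Ck m f \<Longrightarrow> Ck m g \<Longrightarrow> Ck m (\<lambda>x. f x * g x)"
proof (induction m arbitrary: f g)
  case 0
  then show ?case by (simp add: continuous_on_mult)
next
  case (Suc m)
  have "Ck m f" "Ck m g"
    using Suc.prems Ck_SucD by blast+
  then show ?case
    using Suc by (auto simp: partial_deriv_mult intro!: Ck_add Suc.IH)
qed

lemma Ck_prod: "finite I \<Longrightarrow> (\<And>i. i \<in> I \<Longrightarrow> Ck m (f i)) \<Longrightarrow> Ck m (\<lambda>x. \<Prod>i\<in>I. f i x)"
  by (induction I rule: finite_induct) (auto intro: Ck_const Ck_mult)

text \<open>
  The derivative of each \<open>flat k\<close> is a combination of functions of the same family, so smoothness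
  follows by induction on the order.
\<close>

definition flat :: "nat \<Rightarrow> real \<Rightarrow> real" where
  "flat k s = (if s \<le> 0 then 0 else exp (- inverse s) * inverse s ^ k)"

text \<open>From the right, the substitution s = 1/x turns the limit into that of
  \<open>x ^ k / exp x\<close> at infinity; from the left the function is constantly 0.\<close>

lemma flat_tendsto_0: "(flat k \<longlongrightarrow> 0) (at 0)"
proof -
  have "((\<lambda>x. x ^ k / exp x) \<longlongrightarrow> (0::real)) at_top"
    by (rule tendsto_power_div_exp_0)
  then have "((\<lambda>x. exp (- inverse x) * inverse x ^ k) \<longlongrightarrow> (0::real)) (at_right 0)"
    unfolding filterlim_at_right_to_top
    by (rule Lim_transform_eventually)
      (simp add: exp_minus divide_inverse mult.commute)
  then have R: "(flat k \<longlongrightarrow> 0) (at_right 0)"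
    by (rule Lim_transform_eventually)
      (auto simp: flat_def eventually_at_filter divide_inverse)
  have "(flat k \<longlongrightarrow> 0) (at_left 0)"
    by (rule Lim_transform_eventually[of "\<lambda>_. 0"])
      (auto simp: flat_def eventually_at_filter divide_inverse)
  with R show ?thesis by (simp add: filterlim_at_split)
qed

lemma DERIV_flat: "(flat k has_real_derivative flat (k + 2) s - k * flat (k + 1) s) (at s)"
proof -
  consider "s < 0" | "s = 0" | "s > 0" by linarith
  then show ?thesis
  proof cases
    case 1
    then have "eventually (\<lambda>x. x < 0) (nhds s)"
      by (metis eventually_nhds lessThan_iff open_lessThan)
    then have ev: "eventually (\<lambda>x. flat k x = 0) (nhds s)"
      by (rule eventually_mono) (simp add: flat_def)
    have "((\<lambda>_. 0) has_real_derivative 0) (at s)" by simp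
    then show ?thesis using 1 ev
      by (subst DERIV_cong_ev[OF refl ev refl]) (simp add: flat_def)
  next
    case 2
    \<comment> \<open>The difference quotient at 0 is \<open>flat (k + 1)\<close> itself, so
      differentiability at the gluing point reduces to the limit already known.\<close>
    have "((\<lambda>h. (flat k (0 + h) - flat k 0) / h) \<longlongrightarrow> 0) (at 0)"
      by (rule Lim_transform_eventually[OF flat_tendsto_0[of "k + 1"]])
        (auto simp: flat_def eventually_at_filter divide_inverse)
    then show ?thesis using 2 by (simp add: DERIV_def flat_def)
  next
    case 3
    then have "eventually (\<lambda>x. 0 < x) (nhds s)"
      by (metis eventually_nhds greaterThan_iff open_greaterThan)
    then have ev: "eventually (\<lambda>x. flat k x = exp (- inverse x) * inverse x ^ k) (nhds s)"
      by (rule eventually_mono) (simp add: flat_def)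
    \<comment> \<open>Differentiating the power yields the truncated exponent
      \<open>k - Suc 0\<close>. For \<open>k = 0\<close> the factor \<open>real k\<close> makes both
      sides vanish; otherwise the truncation is a true subtraction.\<close>
    have k: "real k * y ^ (k - Suc 0) * (y * y) = real k * y ^ k * y" for y :: real
      by (cases k) auto
    have "((\<lambda>x. exp (- inverse x) * inverse x ^ k) has_real_derivative
        exp (- inverse s) * (inverse s * inverse s) * inverse s ^ k
        - exp (- inverse s) * (real k * inverse s ^ (k - Suc 0) * (inverse s * inverse s))) (at s)"
      using 3 by (auto intro!: derivative_eq_intros simp: algebra_simps)
    then have "((\<lambda>x. exp (- inverse x) * inverse x ^ k) has_real_derivative
        flat (k + 2) s - k * flat (k + 1) s) (at s)"
      unfolding k using 3 by (simp add: flat_def power2_eq_square ac_simps)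
    then show ?thesis
      by (subst DERIV_cong_ev[OF refl ev refl])
  qed
qed

text \<open>The affine argument \<open>c * x $ i + e\<close> serves both kinds of factors of
  \<open>bump\<close>: slope \<open>n\<close> at the lower face and slope \<open>- n\<close> at the
  upper one.\<close>

lemma has_derivative_flat_component:
  "((\<lambda>x. complex_of_real (flat k (c * x $ i + e))) has_derivative
     (\<lambda>h. complex_of_real ((flat (k + 2) (c * x $ i + e) - k * flat (k + 1) (c * x $ i + e))
        * (c * h $ i)))) (at x)"
proof -
  have 1: "((\<lambda>x. c * x $ i + e) has_derivative (\<lambda>h. c * h $ i)) (at x)"
    by (auto intro!: derivative_eq_intros bounded_linear_imp_has_derivative
        bounded_linear_vec_nth)
  show ?thesis
    using has_derivative_compose[OF 1 DERIV_flat[unfolded has_field_derivative_def]]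
    by (rule has_derivative_of_real[where 'a = complex])
qed

lemma Ck_flat_component: "Ck m (\<lambda>x. complex_of_real (flat k (c * x $ i + e)))"
proof (induction m arbitrary: k)
  case 0
  have "continuous (at x) (\<lambda>x. complex_of_real (flat k (c * x $ i + e)))" for x
    by (rule has_derivative_continuous, rule has_derivative_flat_component)
  then show ?case
    unfolding Ck.simps by (blast intro: continuous_at_imp_continuous_on)
next
  case (Suc m)
  have "partial_deriv j (\<lambda>x. complex_of_real (flat k (c * x $ i + e))) =
     (\<lambda>x. complex_of_real (c * axis j 1 $ i) *
       (complex_of_real (flat (k + 2) (c * x $ i + e)) +
        complex_of_real (- k) * complex_of_real (flat (k + 1) (c * x $ i + e))))" for j
    by (rule ext, subst partial_deriv_eq[OF has_derivative_flat_component])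
      (simp add: algebra_simps)
  then have "Ck m (partial_deriv j (\<lambda>x. complex_of_real (flat k (c * x $ i + e))))" for j
    by (simp only:) (intro Ck_mult Ck_add Ck_const Suc.IH)
  moreover have "(\<lambda>x. complex_of_real (flat k (c * x $ i + e))) differentiable (at x)" for x
    using has_derivative_flat_component differentiable_def by blast
  ultimately show ?case unfolding Ck.simps(2) by blast
qed

text \<open>
  The cut-offs \<open>1 / n\<close> away from the faces make the support of the \<open>n\<close>-th bump a compact subset of
  the open box, so that the bumps are test functions and still exhaust the box.
\<close>

definition bump :: "real ^ 'n \<Rightarrow> real ^ 'n \<Rightarrow> nat \<Rightarrow> real ^ 'n \<Rightarrow> real" where
  "bump a b n x =
    (\<Prod>i\<in>UNIV. flat 0 (real n * (x $ i - a $ i) - 1) * flat 0 (real n * (b $ i - x $ i) - 1))"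

lemma flat_0_bounds: "0 \<le> flat 0 s" "flat 0 s \<le> 1"
  by (auto simp: flat_def)

lemma bump_bounds: "0 \<le> bump a b n x" "bump a b n x \<le> 1"
  unfolding bump_def by (auto intro!: prod_nonneg prod_le_1 mult_le_one flat_0_bounds mult_nonneg_nonneg)

lemma bump_nonzeroD:
  assumes "bump a b n x \<noteq> 0"
  shows "1 \<le> real n * (x $ i - a $ i)" "1 \<le> real n * (b $ i - x $ i)"
proof -
  have "flat 0 (real n * (x $ i - a $ i) - 1) * flat 0 (real n * (b $ i - x $ i) - 1) \<noteq> 0"
    using assms unfolding bump_def by (metis (mono_tags, lifting) UNIV_I finite prod_zero)
  then show "1 \<le> real n * (x $ i - a $ i)" "1 \<le> real n * (b $ i - x $ i)"
    by (auto simp: flat_def split: if_splits)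
qed

lemma smooth_bump: "smooth (\<lambda>x. complex_of_real (bump a b n x))"
proof -
  have "(\<lambda>x. complex_of_real (bump a b n x)) =
    (\<lambda>x. \<Prod>i\<in>UNIV. complex_of_real (flat 0 (real n * x $ i + (- real n * a $ i - 1))) *
       complex_of_real (flat 0 (- real n * x $ i + (real n * b $ i - 1))))"
    unfolding bump_def by (simp add: right_diff_distrib algebra_simps del: of_real_add of_real_diff)
  then show ?thesis
    unfolding smooth_def by (simp only:) (intro allI Ck_prod Ck_mult Ck_flat_component finite)
qed

text \<open>The non-strict inequalities of \<open>bump_nonzeroD\<close> define a closed set, so they
  survive the closure, and each of them still forces a positive distance from its face. For
  \<open>n = 0\<close> they are contradictory and the support is empty.\<close>

lemma bump_support:
  "closure {x. complex_of_real (bump a b n x) \<noteq> 0} \<subseteq> box a b"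
proof -
  let ?K = "{x. \<forall>i. 1 \<le> real n * (x $ i - a $ i) \<and> 1 \<le> real n * (b $ i - x $ i)}"
  have "{x. complex_of_real (bump a b n x) \<noteq> 0} \<subseteq> ?K"
    using bump_nonzeroD by fastforce
  moreover have "closed ?K"
    by (auto intro!: closed_Collect_all closed_Collect_conj closed_Collect_le continuous_intros)
  moreover have "?K \<subseteq> box a b"
  proof
    fix x assume x: "x \<in> ?K"
    have "0 < t" if "1 \<le> real n * t" for t
      using that by (smt (verit) mult_nonneg_nonpos of_nat_0_le_iff)
    then show "x \<in> box a b" using x by (fastforce simp: mem_box_cart)
  qed
  ultimately show ?thesis by (meson closure_minimal subset_trans)
qed

lemma test_function_bump:
  assumes "box a b \<subseteq> cell l"
  shows "test_function l (\<lambda>x. complex_of_real (bump a b n x))"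
proof -
  have "compact (closure {x. complex_of_real (bump a b n x) \<noteq> 0})"
    using bounded_subset[OF bounded_box bump_support] by (simp add: compact_eq_bounded_closed)
  with bump_support assms smooth_bump show ?thesis unfolding test_function_def by blast
qed

text \<open>Inside the box all arguments of \<open>flat 0\<close> tend to infinity, where
  \<open>flat 0\<close> tends to 1; outside, every bump vanishes. With the bound 1 this lets
  dominated convergence replace test functions by indicators of boxes.\<close>

lemma bump_tendsto: "(\<lambda>n. bump a b n x) \<longlonglongrightarrow> indicat_real (box a b) x"
proof (cases "x \<in> box a b")
  case True
  have flat1: "(\<lambda>n. flat 0 (real n * s - 1)) \<longlonglongrightarrow> 1" if "0 < s" for s
  proof -
    have "filterlim (\<lambda>n. real n * s) at_top sequentially"
      using filterlim_tendsto_pos_mult_at_top[OF tendsto_const that filterlim_real_sequentially]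
      by (simp add: mult.commute)
    then have lim: "filterlim (\<lambda>n. - 1 + real n * s) at_top sequentially"
      by (intro filterlim_tendsto_add_at_top[OF tendsto_const])
    then have "(\<lambda>n. exp (- inverse (- 1 + real n * s))) \<longlonglongrightarrow> exp (- 0)"
      by (intro tendsto_exp tendsto_minus tendsto_inverse_0_at_top)
    then have "(\<lambda>n. exp (- inverse (- 1 + real n * s))) \<longlonglongrightarrow> 1" by simp
    then show ?thesis
      by (rule Lim_transform_eventually)
        (use eventually_mono[OF filterlim_at_top_dense[THEN iffD1, OF lim, rule_format, of 0]]
         in \<open>auto simp: flat_def\<close>)
  qed
  have "(\<lambda>n. bump a b n x) \<longlonglongrightarrow> (\<Prod>i\<in>(UNIV :: 'a set). 1 * 1)"
    unfolding bump_def using True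
    by (intro tendsto_prod tendsto_mult flat1) (auto simp: mem_box_cart)
  then show ?thesis using True by simp
next
  case False
  then have "bump a b n x = 0" for n
    using subsetD[OF subset_trans[OF closure_subset bump_support], of x a b n] by auto
  then show ?thesis using False by simp
qed

subsection \<open>Square integrable functions\<close>

lemma box_eq_cell: "cell l = box 0 l"
  by (auto simp: cell_def mem_box_cart)

lemma L2_iff:
  "L2 l f \<longleftrightarrow> f \<in> borel_measurable (lebesgue_on (cell l)) \<and>
     integrable (lebesgue_on (cell l)) (\<lambda>x. (norm (f x))\<^sup>2)"
  by (simp add: L2_weighted_def)

lemma L2_measurable: "L2 l f \<Longrightarrow> f \<in> borel_measurable (lebesgue_on (cell l))"
  by (simp add: L2_iff)

lemma L2_dominated:
  assumes g: "L2 l g" and f: "f \<in> borel_measurable (lebesgue_on (cell l))"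
    and le: "AE x in lebesgue_on (cell l). norm (f x) \<le> K * norm (g x)"
  shows "L2 l f"
  unfolding L2_iff
proof
  show "integrable (lebesgue_on (cell l)) (\<lambda>x. (norm (f x))\<^sup>2)"
  proof (rule Bochner_Integration.integrable_bound)
    show "integrable (lebesgue_on (cell l)) (\<lambda>x. K\<^sup>2 * (norm (g x))\<^sup>2)"
      using g by (simp add: L2_iff)
    show "AE x in lebesgue_on (cell l). norm ((norm (f x))\<^sup>2) \<le> norm (K\<^sup>2 * (norm (g x))\<^sup>2)"
      using le
    proof eventually_elim
      case (elim x)
      have "(norm (f x))\<^sup>2 \<le> (K * norm (g x))\<^sup>2"
        by (rule power_mono[OF elim]) simp
      then show ?case by (simp add: power_mult_distrib)
    qed
  qed (use f in measurable)
qed (fact f)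

lemma L2_add:
  fixes f g :: "real ^ 'n \<Rightarrow> 'b::{real_normed_vector, second_countable_topology}"
  assumes f: "L2 l f" and g: "L2 l g"
  shows "L2 l (\<lambda>x. f x + g x)"
proof -
  have m[measurable]: "f \<in> borel_measurable (lebesgue_on (cell l))" "g \<in> borel_measurable (lebesgue_on (cell l))"
    using f g L2_measurable by auto
  have "integrable (lebesgue_on (cell l)) (\<lambda>x. (norm (f x + g x))\<^sup>2)"
  proof (rule Bochner_Integration.integrable_bound)
    show "integrable (lebesgue_on (cell l)) (\<lambda>x. 2 * (norm (f x))\<^sup>2 + 2 * (norm (g x))\<^sup>2)"
      using f g by (simp add: L2_iff)
    have "(norm (f x + g x))\<^sup>2 \<le> 2 * (norm (f x))\<^sup>2 + 2 * (norm (g x))\<^sup>2" for x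
    proof -
      have "(norm (f x + g x))\<^sup>2 \<le> (norm (f x) + norm (g x))\<^sup>2"
        by (intro power_mono norm_triangle_ineq) simp
      also have "\<dots> \<le> 2 * (norm (f x))\<^sup>2 + 2 * (norm (g x))\<^sup>2"
        \<comment> \<open>This is the nonnegative square of the difference of the two norms.\<close>
        using sum_squares_ge_zero[of "norm (f x) - norm (g x)" 0]
        by (simp add: power2_eq_square algebra_simps)
      finally show ?thesis .
    qed
    then show "AE x in lebesgue_on (cell l). norm ((norm (f x + g x))\<^sup>2)
        \<le> norm (2 * (norm (f x))\<^sup>2 + 2 * (norm (g x))\<^sup>2)"
      by simp
  qed measurable
  then show ?thesis using m unfolding L2_iff by simp
qed

lemma L2_of_real_mult:
  fixes f :: "real ^ 'n \<Rightarrow> complex"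
  assumes f: "L2 l f" and b: "b \<in> borel_measurable (lebesgue_on (cell l))"
    and le: "AE x in lebesgue_on (cell l). \<bar>b x\<bar> \<le> K"
  shows "L2 l (\<lambda>x. complex_of_real (b x) * f x)"
proof (rule L2_dominated[OF f])
  show "(\<lambda>x. complex_of_real (b x) * f x) \<in> borel_measurable (lebesgue_on (cell l))"
    using b L2_measurable[OF f] by measurable
  show "AE x in lebesgue_on (cell l). norm (complex_of_real (b x) * f x) \<le> K * norm (f x)"
    using le by eventually_elim (auto simp: norm_mult intro!: mult_right_mono)
qed

lemma L2_mult_left:
  fixes f :: "real ^ 'n \<Rightarrow> complex"
  assumes f: "L2 l f"
  shows "L2 l (\<lambda>x. c * f x)"
  by (rule L2_dominated[OF f, where K = "norm c"]) (use L2_measurable[OF f] in \<open>auto simp: norm_mult\<close>)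

lemma L2_cnj:
  assumes f: "L2 l f"
  shows "L2 l (\<lambda>x. cnj (f x))"
proof (rule L2_dominated[OF f, where K = 1])
  show "(\<lambda>x. cnj (f x)) \<in> borel_measurable (lebesgue_on (cell l))"
    by (rule measurable_compose[OF L2_measurable[OF f]])
      (intro borel_measurable_continuous_onI linear_continuous_on bounded_linear_cnj)
qed simp

lemma L2_diff:
  fixes f g :: "real ^ 'n \<Rightarrow> complex"
  assumes f: "L2 l f" and g: "L2 l g"
  shows "L2 l (\<lambda>x. f x - g x)"
  using L2_add[OF f L2_mult_left[OF g, of "-1"]] by simp

lemma cell_lmeasurable: "cell l \<in> lmeasurable"
  by (simp add: box_eq_cell)

lemma finite_measure_cell: "finite_measure (lebesgue_on (cell l))"
  using cell_lmeasurable by (rule finite_measure_lebesgue_on)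

lemma L2_const: "L2 l (\<lambda>x. c)"
  using finite_measure.integrable_const[OF finite_measure_cell] by (simp add: L2_iff)

text \<open>The product is dominated by the sum of the two squares, which plays the part of the
  Cauchy-Schwarz inequality for integrability.\<close>

lemma L2_mult_integrable:
  fixes f g :: "real ^ 'n \<Rightarrow> complex"
  assumes f: "L2 l f" and g: "L2 l g"
  shows "integrable (lebesgue_on (cell l)) (\<lambda>x. f x * g x)"
proof (rule Bochner_Integration.integrable_bound)
  show "integrable (lebesgue_on (cell l)) (\<lambda>x. (norm (f x))\<^sup>2 + (norm (g x))\<^sup>2)"
    using f g by (simp add: L2_iff)
  show "(\<lambda>x. f x * g x) \<in> borel_measurable (lebesgue_on (cell l))"
    using f g L2_measurable by measurable
  have "norm (f x * g x) \<le> (norm (f x))\<^sup>2 + (norm (g x))\<^sup>2" for x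
    using sum_squares_bound[of "norm (f x)" "norm (g x)"]
      mult_nonneg_nonneg[OF norm_ge_zero[of "f x"] norm_ge_zero[of "g x"]]
    unfolding norm_mult by linarith
  then show "AE x in lebesgue_on (cell l). norm (f x * g x) \<le> norm ((norm (f x))\<^sup>2 + (norm (g x))\<^sup>2)"
    by simp
qed

lemma L2_integrable:
  fixes f :: "real ^ 'n \<Rightarrow> complex"
  shows "L2 l f \<Longrightarrow> integrable (lebesgue_on (cell l)) f"
  using L2_mult_integrable[of l f "\<lambda>_. 1", OF _ L2_const] by simp

lemma L2_nth:
  fixes h :: "real ^ 'n \<Rightarrow> complex ^ 'm"
  assumes h: "L2 l h"
  shows "L2 l (\<lambda>x. h x $ i)"
proof (rule L2_dominated[OF h, where K = 1])
  show "(\<lambda>x. h x $ i) \<in> borel_measurable (lebesgue_on (cell l))"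
    by (rule measurable_compose[OF L2_measurable[OF h]])
      (intro borel_measurable_continuous_onI linear_continuous_on bounded_linear_vec_nth)
qed (simp add: Finite_Cartesian_Product.norm_nth_le)

section \<open>Componentwise treatment of vector-valued integrals\<close>

lemma vec_eq_sum_axis: "x = (\<Sum>i\<in>UNIV. axis i (x $ i))"
  by (simp add: vec_eq_iff axis_def sum.delta if_distrib cong: if_cong)

lemma bounded_linear_axis: "bounded_linear (axis i :: 'b::euclidean_space \<Rightarrow> 'b ^ 'm)"
  by (intro linear_conv_bounded_linear[THEN iffD1] linearI) (auto simp: vec_eq_iff axis_def)

text \<open>A vector is the sum of its coordinate vectors, each a bounded linear image of one
  component. The entry type is left general so that the same facts apply twice to tensors, seen as
  vectors of rows.\<close>

lemma measurable_vec:
  fixes h :: "'a \<Rightarrow> 'b::euclidean_space ^ 'm"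
  assumes "\<And>i. (\<lambda>x. h x $ i) \<in> borel_measurable M"
  shows "h \<in> borel_measurable M"
proof -
  have "(\<lambda>x. axis i (h x $ i) :: 'b ^ 'm) \<in> borel_measurable M" for i
    by (rule measurable_compose[OF assms])
      (intro borel_measurable_continuous_onI linear_continuous_on bounded_linear_axis)
  then have "(\<lambda>x. \<Sum>i\<in>UNIV. axis i (h x $ i)) \<in> borel_measurable M"
    by (rule borel_measurable_sum)
  then show ?thesis by (simp only: vec_eq_sum_axis[symmetric])
qed

lemma integrable_vec:
  fixes h :: "'a \<Rightarrow> 'b::euclidean_space ^ 'm"
  assumes "\<And>i. integrable M (\<lambda>x. h x $ i)"
  shows "integrable M h"
proof -
  have "integrable M (\<lambda>x. axis i (h x $ i) :: 'b ^ 'm)" for i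
    by (rule integrable_bounded_linear[OF bounded_linear_axis assms])
  then have "integrable M (\<lambda>x. \<Sum>i\<in>UNIV. axis i (h x $ i))"
    by (rule Bochner_Integration.integrable_sum)
  then show ?thesis by (simp only: vec_eq_sum_axis[symmetric])
qed

lemma integral_vec_nth:
  fixes h :: "'a \<Rightarrow> 'b::euclidean_space ^ 'm"
  assumes "\<And>i. integrable M (\<lambda>x. h x $ i)"
  shows "(LINT x|M. h x) $ i = (LINT x|M. h x $ i)"
  by (rule integral_bounded_linear[OF bounded_linear_vec_nth integrable_vec[OF assms], symmetric])

lemma norm_vec_power2:
  fixes x :: "'b::real_normed_vector ^ 'm"
  shows "(norm x)\<^sup>2 = (\<Sum>i\<in>UNIV. (norm (x $ i))\<^sup>2)"
  by (simp add: norm_vec_def L2_set_def sum_nonneg)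

lemma L2_vec:
  fixes h :: "real ^ 'n \<Rightarrow> complex ^ 'm"
  assumes "\<And>i. L2 l (\<lambda>x. h x $ i)"
  shows "L2 l h"
  using assms unfolding L2_iff norm_vec_power2 by (auto intro: measurable_vec)

lemma avg_vec_nth:
  fixes h :: "real ^ 'n \<Rightarrow> 'b::euclidean_space ^ 'm"
  assumes "\<And>i. integrable (lebesgue_on (cell l)) (\<lambda>x. h x $ i)"
  shows "avg l h $ i = avg l (\<lambda>x. h x $ i)"
  unfolding avg_def by (simp add: integral_vec_nth[OF assms])

subsection \<open>Weak gradients\<close>

text \<open>
  The integral of a difference quotient over the whole space vanishes by translation invariance.
\<close>

lemma integral_partial_deriv_eq_0:
  assumes "test_function l \<phi>"
  shows "(LINT x|lebesgue_on (cell l). partial_deriv j \<phi> x) = 0"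
proof -
  define D where "D = partial_deriv j \<phi>"
  define S where "S = closure {x. \<phi> x \<noteq> 0}"
  define q where "q n x = (real (Suc n)) *\<^sub>R (\<phi> (inverse (real (Suc n)) *\<^sub>R axis j 1 + x) - \<phi> x)" for n x
  have sm: "Ck (Suc 0) \<phi>" and S: "compact S" "S \<subseteq> cell l"
    using assms unfolding test_function_def smooth_def S_def by auto
  have diff: "(\<phi> has_derivative frechet_derivative \<phi> (at x)) (at x)" for x
    using sm by (simp add: frechet_derivative_works)
  have cD: "continuous_on UNIV D" and c\<phi>: "continuous_on UNIV \<phi>"
    using sm Ck_SucD[OF sm] unfolding D_def by auto
  have \<phi>0: "\<phi> x = 0" if "x \<notin> S" for x
    using that subsetD[OF closure_subset, of x "{x. \<phi> x \<noteq> 0}"] unfolding S_def by auto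
  have D0: "D x = 0" if "x \<notin> S" for x
  proof -
    have "(\<phi> has_derivative (\<lambda>_. 0)) (at x)"
    proof (rule has_derivative_transform_within_open[of "\<lambda>_. 0"])
      show "open (- S)" using S compact_imp_closed by blast
    qed (use that \<phi>0 in auto)
    then show ?thesis unfolding D_def by (rule partial_deriv_eq)
  qed
  obtain B where B: "\<And>x. norm (D x) \<le> B" "0 \<le> B"
  proof -
    have "compact (D ` S)"
      using S cD compact_continuous_image continuous_on_subset by blast
    then obtain B where "\<And>x. x \<in> S \<Longrightarrow> norm (D x) \<le> B"
      by (metis bounded_iff compact_imp_bounded imageI)
    then have "norm (D x) \<le> max B 0" for x
      using D0[of x] by (cases "x \<in> S") (auto simp: le_max_iff_disj)
    then show thesis using that by (metis max.cobounded2)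
  qed
  have line: "((\<lambda>t. \<phi> (t *\<^sub>R axis j 1 + x)) has_vector_derivative D (t *\<^sub>R axis j 1 + x)) (at t)"
    for t x
  proof -
    have 1: "((\<lambda>t. t *\<^sub>R axis j 1 + x) has_derivative (\<lambda>h. h *\<^sub>R axis j 1)) (at t)"
      by (auto intro!: derivative_eq_intros)
    have "linear (frechet_derivative \<phi> (at (t *\<^sub>R axis j 1 + x)))"
      using diff has_derivative_linear by blast
    then show ?thesis
      using has_derivative_compose[OF 1 diff]
      unfolding has_vector_derivative_def D_def partial_deriv_def by (simp add: linear_cmul)
  qed
  \<comment> \<open>The mean value inequality along direction \<open>j\<close> bounds all difference
    quotients by the same \<open>B\<close> that bounds the partial derivative.\<close>
  have lip: "norm (\<phi> (t *\<^sub>R axis j 1 + x) - \<phi> x) \<le> B * t" if "0 \<le> t" for t x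
  proof -
    have "norm (\<phi> (t *\<^sub>R axis j 1 + x) - \<phi> (0 *\<^sub>R axis j 1 + x)) \<le> B * norm (t - 0)"
      using line B that
      by (intro differentiable_bound[where S = UNIV and f' = "\<lambda>t h. h *\<^sub>R D (t *\<^sub>R axis j 1 + x)"])
        (auto simp: has_vector_derivative_def mult.commute[of B]
          intro!: onorm_bound mult_left_mono)
    then show ?thesis using that by simp
  qed
  have q_lim: "(\<lambda>n. q n x) \<longlonglongrightarrow> D x" for x
  proof -
    have "((\<lambda>h. norm (\<phi> (h *\<^sub>R axis j 1 + x) - \<phi> x - h *\<^sub>R D x) / norm h) \<longlongrightarrow> 0) (at 0)"
      using line[of x 0] unfolding has_vector_derivative_def has_derivative_at by simp
    moreover have "filterlim (\<lambda>n. inverse (real (Suc n))) (at 0) sequentially"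
      using LIMSEQ_inverse_real_of_nat by (auto simp: filterlim_at)
    ultimately have "(\<lambda>n. norm (\<phi> (inverse (real (Suc n)) *\<^sub>R axis j 1 + x) - \<phi> x
        - inverse (real (Suc n)) *\<^sub>R D x) / norm (inverse (real (Suc n)))) \<longlonglongrightarrow> 0"
      by (rule filterlim_compose)
    moreover have "norm (\<phi> (inverse (real (Suc n)) *\<^sub>R axis j 1 + x) - \<phi> x
        - inverse (real (Suc n)) *\<^sub>R D x) / norm (inverse (real (Suc n))) = norm (q n x - D x)" for n
    proof -
      have "q n x - D x = real (Suc n) *\<^sub>R (\<phi> (inverse (real (Suc n)) *\<^sub>R axis j 1 + x) - \<phi> x
        - inverse (real (Suc n)) *\<^sub>R D x)"
        unfolding q_def by (simp add: scaleR_diff_right del: of_nat_Suc)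
      then show ?thesis by (simp add: divide_inverse del: of_nat_Suc)
    qed
    ultimately have "(\<lambda>n. norm (q n x - D x)) \<longlonglongrightarrow> 0" by simp
    then show ?thesis by (rule LIM_zero_cancel[OF tendsto_norm_zero_cancel])
  qed
  obtain R where R: "S \<subseteq> cball 0 R"
    using compact_imp_bounded[OF S(1)] that by (auto simp: bounded_iff subset_iff)
  \<comment> \<open>The steps have length at most 1, so every quotient is supported in the ball of
    radius \<open>R + 1\<close>. Together with the bound \<open>B\<close> this gives one integrable
    majorant for all \<open>n\<close>.\<close>
  have q_bound: "norm (q n x) \<le> B * indicat_real (cball 0 (R + 1)) x" for n x
  proof (cases "x \<in> cball 0 (R + 1)")
    case True
    have "norm (q n x) \<le> real (Suc n) * (B * inverse (real (Suc n)))"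
      unfolding q_def norm_scaleR using lip[of "inverse (real (Suc n))" x]
      by (intro mult_mono) auto
    also have "\<dots> = B" by (simp del: of_nat_Suc)
    finally show ?thesis using True by simp
  next
    case False
    have "norm (inverse (real (Suc n)) *\<^sub>R axis j 1 :: real^'a) \<le> 1"
      by (simp add: inverse_eq_divide)
    then have "norm x \<le> norm (inverse (real (Suc n)) *\<^sub>R axis j 1 + x) + 1"
      using norm_triangle_ineq4[of "inverse (real (Suc n)) *\<^sub>R axis j 1 + x"
          "inverse (real (Suc n)) *\<^sub>R axis j 1"] by simp
    then have "inverse (real (Suc n)) *\<^sub>R axis j 1 + x \<notin> S" "x \<notin> S"
      using False R by (auto dest!: subsetD)
    then show ?thesis using \<phi>0 False B by (simp add: q_def)
  qed
  have c\<phi>': "continuous_on UNIV (\<lambda>x. \<phi> (c + x))" for c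
    by (intro continuous_on_compose2[OF c\<phi>] continuous_intros) auto
  have m\<phi>: "\<phi> \<in> borel_measurable lborel" "(\<lambda>x. \<phi> (c + x)) \<in> borel_measurable lborel" for c
    using c\<phi> c\<phi>' borel_measurable_continuous_onI by auto
  have "indicat_real S x *\<^sub>R \<phi> x = \<phi> x" for x
    using \<phi>0 by (auto simp: indicator_def)
  then have int\<phi>: "integrable lborel \<phi>"
    using borel_integrable_compact[OF S(1) continuous_on_subset[OF c\<phi>]] by simp
  have trans: "(LINT x|lborel. \<phi> (c + x)) = (LINT x|lborel. \<phi> x)"
      "integrable lborel (\<lambda>x. \<phi> (c + x))" for c
    using integral_distr[of "(+) c" lborel borel \<phi>] integrable_distr_eq[of "(+) c" lborel borel \<phi>]
      m\<phi> int\<phi> by (simp_all add: lborel_distr_plus)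
  have q0: "(LINT x|lborel. q n x) = 0" for n
    unfolding q_def using trans int\<phi> by (simp add: Bochner_Integration.integral_diff)
  have "(\<lambda>n. LINT x|lborel. q n x) \<longlonglongrightarrow> (LINT x|lborel. D x)"
  proof (rule integral_dominated_convergence)
    show "D \<in> borel_measurable lborel"
      using borel_measurable_continuous_onI[OF cD] by simp
    show "q n \<in> borel_measurable lborel" for n
      unfolding q_def using m\<phi> by measurable
    show "integrable lborel (\<lambda>x. B * indicat_real (cball 0 (R + 1)) x)"
      by (intro integrable_mult_right integrable_real_indicator emeasure_lborel_cball_finite) simp
  qed (use q_lim q_bound in auto)
  then have "(LINT x|lborel. D x) = 0"
    unfolding q0 by (simp add: LIMSEQ_const_iff)
  moreover have "indicat_real (cell l) x *\<^sub>R D x = D x" for x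
    using D0 S by (auto simp: indicator_def)
  moreover have "cell l \<in> sets lebesgue"
    by (simp add: box_eq_cell)
  moreover have "(LINT x|lebesgue. D x) = (LINT x|lborel. D x)"
    using borel_measurable_continuous_onI[OF cD] by (simp add: integral_completion)
  ultimately show ?thesis
    unfolding D_def by (simp add: integral_restrict_space)
qed

section \<open>The fundamental lemma of the calculus of variations\<close>

lemma cell_sets: "cell l \<in> sets lebesgue"
  by (simp add: box_eq_cell)

lemma L2_continuous:
  assumes f: "continuous_on UNIV f"
  shows "L2 l f"
proof -
  have "bounded (f ` cbox 0 l)"
    by (intro compact_imp_bounded compact_continuous_image continuous_on_subset[OF f]) auto
  then obtain B where B: "\<And>x. x \<in> cbox 0 l \<Longrightarrow> norm (f x) \<le> B"
    unfolding bounded_iff by blast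
  show ?thesis
  proof (rule L2_dominated[OF L2_const[of l "1::real"], where K = B])
    show "f \<in> borel_measurable (lebesgue_on (cell l))"
      by (rule continuous_imp_measurable_on_sets_lebesgue[OF continuous_on_subset[OF f] cell_sets]) simp
    show "AE x in lebesgue_on (cell l). norm (f x) \<le> B * norm (1::real)"
      using B box_subset_cbox[of 0 l] by (auto intro!: AE_I2 simp: space_restrict_space box_eq_cell)
  qed
qed

lemma L2_test_function:
  assumes "test_function l \<phi>"
  shows "L2 l \<phi>" "L2 l (partial_deriv j \<phi>)"
proof -
  have "Ck 0 \<phi>" "Ck (Suc 0) \<phi>"
    using assms unfolding test_function_def smooth_def by blast+
  then show "L2 l \<phi>" "L2 l (partial_deriv j \<phi>)"
    by (auto intro: L2_continuous)
qed

text \<open>A Dynkin-class argument. Bumps converge to the indicator of any box inside the cell, so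
  \<open>d\<close> integrates to zero over such boxes. Open boxes are stable under intersection and
  generate the Borel sets, and the sets over which \<open>d\<close> integrates to zero are closed
  under complements and countable disjoint unions.\<close>

lemma integral_borel_eq_0_if_orthogonal:
  fixes d :: "real ^ 'n \<Rightarrow> complex"
  assumes d: "integrable (lebesgue_on (cell l)) d"
    and orth: "\<And>\<phi>. test_function l \<phi> \<Longrightarrow> (LINT x|lebesgue_on (cell l). d x * \<phi> x) = 0"
    and A: "A \<in> sets borel"
  shows "(LINT x:A|lebesgue_on (cell l). d x) = 0"
proof -
  let ?M = "lebesgue_on (cell l)"
  \<comment> \<open>A Borel set may leave the cell and then is no member of \<open>sets ?M\<close>.
    Its trace on the cell is one and carries the same integral.\<close>
  have borelM: "B \<inter> cell l \<in> sets ?M" if "B \<in> sets borel" for B :: "(real ^ 'n) set"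
    using that cell_sets by (auto simp: sets_restrict_space)
  have ind: "set_integrable ?M B d" if "B \<in> sets borel" for B
  proof -
    have "set_integrable ?M (B \<inter> cell l) d"
      using integrable_mult_indicator[OF borelM[OF that] d] by (simp add: set_integrable_def)
    then show ?thesis
      unfolding set_integrable_def
      by (rule Bochner_Integration.integrable_cong[THEN iffD1, OF refl, rotated])
        (auto simp: space_restrict_space indicator_def)
  qed
  have box0: "(LINT x:box a b|?M. d x) = 0" if sub: "box a b \<subseteq> cell l" for a b
  proof -
    have "(\<lambda>n. LINT x|?M. d x * complex_of_real (bump a b n x))
        \<longlonglongrightarrow> (LINT x|?M. d x * complex_of_real (indicat_real (box a b) x))"
    proof (rule integral_dominated_convergence)
      show "integrable ?M (\<lambda>x. norm (d x))" using d by simp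
      show "(\<lambda>x. d x * complex_of_real (bump a b n x)) \<in> borel_measurable ?M" for n
        using d L2_measurable[OF L2_test_function(1)[OF test_function_bump[OF sub]]]
        by (intro borel_measurable_times) auto
      show "(\<lambda>x. d x * complex_of_real (indicat_real (box a b) x)) \<in> borel_measurable ?M"
        using borel_measurable_integrable[OF ind[of "box a b", unfolded set_integrable_def]]
        by (simp add: scaleR_conv_of_real mult.commute)
      show "AE x in ?M. (\<lambda>n. d x * complex_of_real (bump a b n x))
          \<longlonglongrightarrow> d x * complex_of_real (indicat_real (box a b) x)"
        by (intro AE_I2 tendsto_mult tendsto_const tendsto_of_real bump_tendsto)
      show "AE x in ?M. norm (d x * complex_of_real (bump a b n x)) \<le> norm (d x)" for n
        using bump_bounds[of a b n] by (auto simp: norm_mult intro!: AE_I2 mult_left_le)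
    qed
    then have "(LINT x|?M. d x * complex_of_real (indicat_real (box a b) x)) = 0"
      using orth[OF test_function_bump[OF sub]] by (simp add: LIMSEQ_const_iff)
    then show ?thesis
      by (simp add: set_lebesgue_integral_def scaleR_conv_of_real mult.commute)
  qed
  \<comment> \<open>The cell is itself a box; its vanishing integral is what makes the complement
    case work.\<close>
  have cell0: "(LINT x|?M. d x) = 0"
  proof -
    have "(LINT x|?M. d x) = (LINT x:box 0 l|?M. d x)"
      unfolding set_lebesgue_integral_def
      by (rule Bochner_Integration.integral_cong) (auto simp: box_eq_cell space_restrict_space)
    then show ?thesis using box0[of 0 l] by (simp add: box_eq_cell)
  qed
  have "Int_stable (range (\<lambda>(a, b). box a b :: (real ^ 'n) set))"
    by (fastforce intro!: Int_stableI simp: box_Int_box)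
  moreover have "range (\<lambda>(a, b). box a b) \<subseteq> Pow (UNIV :: (real ^ 'n) set)"
    by auto
  moreover have "A \<in> sigma_sets UNIV (range (\<lambda>(a, b). box a b))"
    using A unfolding borel_eq_box by simp
  ultimately show ?thesis
  proof (induction rule: sigma_sets_induct_disjoint)
    case (basic A)
    then obtain a b where A: "A = box a b" by auto
    \<comment> \<open>A generating box may stick out of the cell, but its intersection with the cell
      is again a box.\<close>
    obtain a' b' where ab: "A \<inter> cell l = box a' b'"
      unfolding A box_eq_cell box_Int_box by blast
    have "(LINT x:A|?M. d x) = (LINT x:box a' b'|?M. d x)"
      unfolding set_lebesgue_integral_def ab[symmetric]
      by (rule Bochner_Integration.integral_cong) (auto simp: space_restrict_space indicator_def)
    then show ?case using box0 ab by (metis Int_lower2)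
  next
    case empty
    then show ?case by (simp add: set_lebesgue_integral_def)
  next
    case (compl A)
    then have A: "A \<in> sets borel" by (simp add: borel_eq_box)
    have "(LINT x|?M. indicator A x *\<^sub>R d x + indicator (UNIV - A) x *\<^sub>R d x)
        = (LINT x:A|?M. d x) + (LINT x:UNIV - A|?M. d x)"
      unfolding set_lebesgue_integral_def
      using A by (intro Bochner_Integration.integral_add ind[unfolded set_integrable_def]) auto
    moreover have "indicator A x *\<^sub>R d x + indicator (UNIV - A) x *\<^sub>R d x = d x" for x
      by (auto simp: indicator_def)
    ultimately show ?case using compl.IH cell0 by simp
  next
    case (union F)
    then have F: "F i \<in> sets borel" for i
      by (auto simp: borel_eq_box)
    have "(LINT x:(\<Union>i. F i)|?M. d x) = (LINT x:(\<Union>i. F i \<inter> cell l)|?M. d x)"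
      unfolding set_lebesgue_integral_def
      by (rule Bochner_Integration.integral_cong) (auto simp: space_restrict_space indicator_def)
    also have "\<dots> = (\<Sum>i. LINT x:F i \<inter> cell l|?M. d x)"
    proof (rule lebesgue_integral_countable_add)
      show "F i \<inter> cell l \<in> sets ?M" for i using F borelM by blast
      show "F i \<inter> cell l \<inter> (F j \<inter> cell l) = {}" if "i \<noteq> j" for i j
        using union(1) that by (auto simp: disjoint_family_on_def)
      have "(\<Union>i. F i \<inter> cell l) \<in> sets ?M" using F borelM by blast
      then show "set_integrable ?M (\<Union>i. F i \<inter> cell l) d"
        using d by (simp add: set_integrable_def integrable_mult_indicator)
    qed
    also have "\<dots> = (\<Sum>i. LINT x:F i|?M. d x)"
      unfolding set_lebesgue_integral_def
      by (intro suminf_cong Bochner_Integration.integral_cong)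
        (auto simp: space_restrict_space indicator_def)
    finally show ?case using union.IH by simp
  qed
qed

text \<open>On the set where the function is positive the integrand is nonnegative with integral
  zero, so that set is null. The same applies to the negated function.\<close>

lemma AE_eq_0_if_set_integrals_0:
  fixes d :: "'a \<Rightarrow> real"
  assumes d: "integrable M d" and 0: "\<And>A. A \<in> sets M \<Longrightarrow> (LINT x:A|M. d x) = 0"
  shows "AE x in M. d x = 0"
proof -
  have nonpos: "AE x in M. e x \<le> 0"
    if e: "integrable M e" and e0: "\<And>A. A \<in> sets M \<Longrightarrow> (LINT x:A|M. e x) = 0"
    for e :: "'a \<Rightarrow> real"
  proof -
    let ?A = "{x \<in> space M. 0 < e x}"
    have A: "?A \<in> sets M" using e by measurable
    have "integrable M (\<lambda>x. indicat_real ?A x * e x)"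
      using integrable_mult_indicator[OF A e] by simp
    then have "AE x in M. indicat_real ?A x * e x = 0"
      using e0[OF A] unfolding set_lebesgue_integral_def
      by (subst integral_nonneg_eq_0_iff_AE[symmetric]) (auto simp: indicator_def)
    then show ?thesis
      using AE_space by eventually_elim (auto simp: indicator_def split: if_splits)
  qed
  have "AE x in M. - d x \<le> 0"
    using d 0 by (intro nonpos) (auto simp: set_lebesgue_integral_def)
  moreover have "AE x in M. d x \<le> 0"
    using d 0 by (intro nonpos) auto
  ultimately show ?thesis by eventually_elim auto
qed

text \<open>Two gaps separate this from the preceding lemmas: passing from Borel to Lebesgue
  measurable sets, and from complex to real functions by taking real and imaginary parts.\<close>

lemma AE_eq_0_if_orthogonal_test_functions:
  fixes d :: "real ^ 'n \<Rightarrow> complex"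
  assumes d: "integrable (lebesgue_on (cell l)) d"
    and orth: "\<And>\<phi>. test_function l \<phi> \<Longrightarrow> (LINT x|lebesgue_on (cell l). d x * \<phi> x) = 0"
  shows "AE x in lebesgue_on (cell l). d x = 0"
proof -
  let ?M = "lebesgue_on (cell l)"
  have 0: "(LINT x:A|?M. d x) = 0" if "A \<in> sets ?M" for A
  proof -
    have "A \<in> sets lebesgue" and sub: "A \<subseteq> cell l"
      using that sets_restrict_space_iff[of "cell l" lebesgue A] cell_sets
        sets.sets_into_space[OF that] by (auto simp: space_restrict_space)
    \<comment> \<open>Up to a subset of a Borel null set, a Lebesgue measurable set is a Borel set
      \<open>S\<close>, and null sets do not change the integral.\<close>
    from this(1) obtain S N N' where S: "A = S \<union> N" "N \<subseteq> N'" "N' \<in> null_sets lborel" "S \<in> sets lborel"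
      by (elim sets_completionE)
    have SM: "S \<in> sets ?M"
      using S(1,4) sub sets_restrict_space_iff[of "cell l" lebesgue S] cell_sets
      by (auto simp: space_restrict_space)
    have "AE x in lebesgue. x \<notin> N'"
      using S(3) by (intro AE_not_in null_sets_completionI)
    then have "AE x in ?M. indicat_real A x *\<^sub>R d x = indicat_real S x *\<^sub>R d x"
      using S(1,2) cell_sets
      by (subst AE_restrict_space_iff) (auto elim!: eventually_mono simp: indicator_def)
    then have "(LINT x:A|?M. d x) = (LINT x:S|?M. d x)"
      unfolding set_lebesgue_integral_def using that SM borel_measurable_integrable[OF d]
      by (intro integral_cong_AE borel_measurable_scaleR borel_measurable_indicator)
    then show ?thesis using integral_borel_eq_0_if_orthogonal[OF d orth] S(4) by simp
  qed
  have ind: "integrable ?M (\<lambda>x. indicator A x *\<^sub>R d x)" if "A \<in> sets ?M" for A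
    by (rule integrable_mult_indicator[OF that d])
  have "(LINT x:A|?M. Re (d x)) = 0" "(LINT x:A|?M. Im (d x)) = 0" if "A \<in> sets ?M" for A
    using integral_bounded_linear[OF bounded_linear_Re ind[OF that]]
      integral_bounded_linear[OF bounded_linear_Im ind[OF that]] 0[OF that]
    by (simp_all add: set_lebesgue_integral_def)
  then have "AE x in ?M. Re (d x) = 0" "AE x in ?M. Im (d x) = 0"
    using d by (auto intro!: AE_eq_0_if_set_integrals_0)
  then show ?thesis by eventually_elim (simp add: complex_eq_iff)
qed

text \<open>Both candidates satisfy the defining identity with the same left-hand side, so each
  component of their difference is orthogonal to all test functions.\<close>

lemma is_weak_grad_unique:
  assumes h: "L2 l h" "is_weak_grad l g h" and h': "L2 l h'" "is_weak_grad l g h'"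
  shows "AE x in lebesgue_on (cell l). h x = h' x"
proof -
  have "AE x in lebesgue_on (cell l). h x $ j - h' x $ j = 0" for j
  proof (rule AE_eq_0_if_orthogonal_test_functions)
    show "integrable (lebesgue_on (cell l)) (\<lambda>x. h x $ j - h' x $ j)"
      by (intro L2_integrable L2_diff L2_nth h h')
    fix \<phi> assume \<phi>: "test_function l \<phi>"
    have "(LINT x|lebesgue_on (cell l). (h x $ j - h' x $ j) * \<phi> x) =
      (LINT x|lebesgue_on (cell l). h x $ j * \<phi> x) - (LINT x|lebesgue_on (cell l). h' x $ j * \<phi> x)"
      unfolding left_diff_distrib
      by (intro Bochner_Integration.integral_diff L2_mult_integrable L2_nth h h' L2_test_function[OF \<phi>])
    also have "\<dots> = 0"
      using h(2)[unfolded is_weak_grad_def, rule_format, OF \<phi>, of j]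
        h'(2)[unfolded is_weak_grad_def, rule_format, OF \<phi>, of j] by simp
    finally show "(LINT x|lebesgue_on (cell l). (h x $ j - h' x $ j) * \<phi> x) = 0" .
  qed
  then have "AE x in lebesgue_on (cell l). \<forall>j\<in>UNIV. h x $ j - h' x $ j = 0"
    by (intro AE_finite_allI) auto
  then show ?thesis by eventually_elim (simp add: vec_eq_iff)
qed

text \<open>The \<open>L2\<close> hypotheses make all products with test functions integrable, so
  that the integrals split.\<close>

lemma is_weak_grad_add:
  assumes "L2 l f" "L2 l h" "is_weak_grad l f h" "L2 l g" "L2 l h'" "is_weak_grad l g h'"
  shows "is_weak_grad l (\<lambda>x. f x + g x) (\<lambda>x. h x + h' x)"
  unfolding is_weak_grad_def
proof (intro allI impI)
  fix \<phi> j assume \<phi>: "test_function l \<phi>"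
  note int = L2_mult_integrable[OF _ L2_test_function(1)[OF \<phi>]]
    L2_mult_integrable[OF _ L2_test_function(2)[OF \<phi>]]
  show "(LINT x|lebesgue_on (cell l). (f x + g x) * partial_deriv j \<phi> x) =
      - (LINT x|lebesgue_on (cell l). (h x + h' x) $ j * \<phi> x)"
    using assms(3,6) \<phi> unfolding is_weak_grad_def
    by (simp add: distrib_right Bochner_Integration.integral_add int assms(1,4) L2_nth assms(2,5))
qed

lemma is_weak_grad_scale:
  assumes "is_weak_grad l f h"
  shows "is_weak_grad l (\<lambda>x. c * f x) (\<lambda>x. c *s h x)"
  unfolding is_weak_grad_def
proof (intro allI impI)
  fix \<phi> j assume "test_function l \<phi>"
  then show "(LINT x|lebesgue_on (cell l). c * f x * partial_deriv j \<phi> x) =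
      - (LINT x|lebesgue_on (cell l). (c *s h x) $ j * \<phi> x)"
    using assms[unfolded is_weak_grad_def, rule_format, of \<phi> j] by (simp add: mult.assoc)
qed

lemma L2_scale_vec:
  fixes h :: "real ^ 'n \<Rightarrow> complex ^ 'm"
  shows "L2 l h \<Longrightarrow> L2 l (\<lambda>x. c *s h x)"
  unfolding vector_scalar_mult_def by (rule L2_vec) (simp, intro L2_mult_left L2_nth)

lemma is_weak_grad_const: "is_weak_grad l (\<lambda>x. c) (\<lambda>x. 0)"
  unfolding is_weak_grad_def using integral_partial_deriv_eq_0 by auto

section \<open>Calculus of the chosen gradient\<close>

lemma H1_L2: "H1 l g \<Longrightarrow> L2 l g"
  by (simp add: H1_def)

lemma
  assumes "H1 l g"
  shows grad_L2: "L2 l (grad l g)" and is_weak_grad_grad: "is_weak_grad l g (grad l g)"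
proof -
  have "\<exists>h. L2 l h \<and> is_weak_grad l g h" using assms by (simp add: H1_def)
  from someI_ex[OF this] show "L2 l (grad l g)" "is_weak_grad l g (grad l g)"
    by (simp_all add: grad_def)
qed

text \<open>Any explicit weak gradient may replace the choice made by \<open>grad\<close>, at the
  price of a null set. Linearity and the case of constants are instances.\<close>

lemma grad_AE_eq:
  assumes "L2 l g" "L2 l h" "is_weak_grad l g h"
  shows "AE x in lebesgue_on (cell l). grad l g x = h x"
proof -
  have "H1 l g" using assms unfolding H1_def by blast
  then show ?thesis
    by (intro is_weak_grad_unique[OF grad_L2 is_weak_grad_grad assms(2,3)])
qed

lemma H1_add: "H1 l f \<Longrightarrow> H1 l g \<Longrightarrow> H1 l (\<lambda>x. f x + g x)"
  unfolding H1_def by (blast intro: L2_add is_weak_grad_add)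

lemma H1_scale: "H1 l f \<Longrightarrow> H1 l (\<lambda>x. c * f x)"
  unfolding H1_def by (blast intro: L2_mult_left L2_scale_vec is_weak_grad_scale)

lemma H1_const: "H1 l (\<lambda>x. c)"
  unfolding H1_def by (blast intro: L2_const is_weak_grad_const)

lemma H1_sum: "finite I \<Longrightarrow> (\<And>i. i \<in> I \<Longrightarrow> H1 l (f i)) \<Longrightarrow> H1 l (\<lambda>x. \<Sum>i\<in>I. f i x)"
  by (induction I rule: finite_induct) (auto intro: H1_const H1_add)

lemma kgrad_add:
  assumes f: "H1 l f" and g: "H1 l g"
  shows "AE x in lebesgue_on (cell l). kgrad l k (\<lambda>x. f x + g x) x = kgrad l k f x + kgrad l k g x"
proof -
  have "AE x in lebesgue_on (cell l). grad l (\<lambda>x. f x + g x) x = grad l f x + grad l g x"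
    by (intro grad_AE_eq L2_add is_weak_grad_add H1_L2 grad_L2 is_weak_grad_grad f g)
  then show ?thesis
    by eventually_elim (simp add: kgrad_def vec_eq_iff algebra_simps)
qed

lemma kgrad_scale:
  assumes f: "H1 l f"
  shows "AE x in lebesgue_on (cell l). kgrad l k (\<lambda>x. c * f x) x = c *s kgrad l k f x"
proof -
  have "AE x in lebesgue_on (cell l). grad l (\<lambda>x. c * f x) x = c *s grad l f x"
    by (intro grad_AE_eq L2_mult_left L2_scale_vec is_weak_grad_scale H1_L2 grad_L2 is_weak_grad_grad f)
  then show ?thesis
    by eventually_elim (simp add: kgrad_def vec_eq_iff algebra_simps)
qed

lemma kgrad_const:
  "AE x in lebesgue_on (cell l). kgrad l k (\<lambda>x. c) x = (\<i> * c) *s cvec k"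
proof -
  have "AE x in lebesgue_on (cell l). grad l (\<lambda>x. c) x = 0"
    by (intro grad_AE_eq L2_const is_weak_grad_const)
  then show ?thesis
    by eventually_elim (simp add: kgrad_def cvec_def vec_eq_iff algebra_simps)
qed

lemma kgrad_sum:
  assumes "finite I" "\<And>i. i \<in> I \<Longrightarrow> H1 l (f i)"
  shows "AE x in lebesgue_on (cell l). kgrad l k (\<lambda>x. \<Sum>i\<in>I. f i x) x = (\<Sum>i\<in>I. kgrad l k (f i) x)"
  using assms
proof (induction I rule: finite_induct)
  \<comment> \<open>The empty sum is the constant 0, and even its chosen gradient vanishes only
    almost everywhere.\<close>
  case empty
  then show ?case using kgrad_const[of l k 0] by simp
next
  case (insert i I)
  have "AE x in lebesgue_on (cell l). kgrad l k (\<lambda>x. f i x + (\<Sum>i\<in>I. f i x)) x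
      = kgrad l k (f i) x + kgrad l k (\<lambda>x. \<Sum>i\<in>I. f i x) x"
    using insert by (intro kgrad_add H1_sum) auto
  moreover have "AE x in lebesgue_on (cell l). kgrad l k (\<lambda>x. \<Sum>i\<in>I. f i x) x
      = (\<Sum>i\<in>I. kgrad l k (f i) x)"
    using insert by auto
  ultimately show ?case
    unfolding sum.insert[OF insert.hyps] by eventually_elim simp
qed

lemma kgrad_L2:
  assumes "H1 l f"
  shows "L2 l (kgrad l k f)"
proof (rule L2_vec)
  fix i
  show "L2 l (\<lambda>x. kgrad l k f x $ i)"
    unfolding kgrad_def
    by (simp add: L2_add[OF L2_nth[OF grad_L2[OF assms]] L2_mult_left[OF H1_L2[OF assms]]])
qed

text \<open>The constant is its own approximating sequence and its own encoded trace on every face.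
  The one point to check is convergence of the classical gradients 0 to the chosen representative,
  which is 0 only almost everywhere.\<close>

lemma H1_per_const: "H1_per l (\<lambda>x. c)"
proof -
  have cg: "classical_grad (\<lambda>x. c) = (\<lambda>x. 0)"
    by (simp add: classical_grad_def fun_eq_iff vec_eq_iff)
  have "AE x in lebesgue_on (cell l). grad l (\<lambda>x. c) x = 0"
    by (intro grad_AE_eq L2_const is_weak_grad_const)
  then have g0: "AE x in lebesgue_on (cell l). (norm (0 - grad l (\<lambda>x. c) x))\<^sup>2 = 0"
    by eventually_elim simp
  have meas: "grad l (\<lambda>x. c) \<in> borel_measurable (lebesgue_on (cell l))"
    using H1_const grad_L2 L2_measurable by blast
  have "L2 l (\<lambda>x. 0 - grad l (\<lambda>x. c) x)"
    by (rule L2_dominated[OF grad_L2[OF H1_const[of l c]], where K = 1])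
      (use meas in auto)
  moreover have "(LINT x|lebesgue_on (cell l). (norm (0 - grad l (\<lambda>x. c) x))\<^sup>2) = 0"
    by (rule integral_eq_zero_AE[OF g0])
  ultimately have "converges_L2 l (\<lambda>n. classical_grad (\<lambda>x. c)) (grad l (\<lambda>x. c))"
    unfolding converges_L2_weighted_def cg by simp
  moreover have "converges_L2 l (\<lambda>n x. c) (\<lambda>x. c)"
    unfolding converges_L2_weighted_def using L2_const[of l "0::complex"] by simp
  moreover have "smooth (\<lambda>x. c)"
    by (simp add: smooth_def Ck_const)
  ultimately have "face_trace l j a (\<lambda>x. c) (\<lambda>x. c)" for j a
    unfolding face_trace_def by (intro exI[of _ "\<lambda>n x. c"]) simp
  then show ?thesis unfolding H1_per_def using H1_const by blast
qed

subsection \<open>The sesquilinear form of the cell problems\<close>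

lemma admissible_coefficient_bounded:
  assumes "admissible_coefficient l g"
  obtains K where "AE x in lebesgue_on (cell l). \<bar>g x\<bar> \<le> K"
  using assms unfolding admissible_coefficient_def by blast

lemma admissible_coefficient_measurable:
  "admissible_coefficient l g \<Longrightarrow> g \<in> borel_measurable (lebesgue_on (cell l))"
  by (simp add: admissible_coefficient_def)

lemma admissible_coefficient_nonneg:
  assumes "admissible_coefficient l g"
  shows "AE x in lebesgue_on (cell l). 0 \<le> g x"
proof -
  obtain c where "0 < c" and c: "AE x in lebesgue_on (cell l). c \<le> g x"
    using assms unfolding admissible_coefficient_def by blast
  from c show ?thesis by eventually_elim (use \<open>0 < c\<close> in simp)
qed

lemma L2_coefficient:
  fixes f :: "real ^ 'n \<Rightarrow> complex"
  assumes g: "admissible_coefficient l g" and f: "L2 l f"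
  shows "L2 l (\<lambda>x. complex_of_real (g x) * f x)"
  using admissible_coefficient_bounded[OF g]
    L2_of_real_mult[OF f admissible_coefficient_measurable[OF g]] by blast

lemma H1_per_H1: "H1_per l g \<Longrightarrow> H1 l g"
  by (simp add: H1_per_def)

lemma avg_cong_AE:
  assumes "f \<in> borel_measurable (lebesgue_on (cell l))" "g \<in> borel_measurable (lebesgue_on (cell l))"
    and "AE x in lebesgue_on (cell l). f x = g x"
  shows "avg l f = avg l g"
  unfolding avg_def using integral_cong_AE[OF assms] by simp

lemma avg_add:
  assumes "integrable (lebesgue_on (cell l)) f" "integrable (lebesgue_on (cell l)) g"
  shows "avg l (\<lambda>x. f x + g x) = avg l f + avg l g"
  unfolding avg_def using assms by (simp add: scaleR_add_right)

lemma avg_mult: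
  fixes f :: "real ^ 'n \<Rightarrow> complex"
  shows "avg l (\<lambda>x. c * f x) = c * avg l f"
  unfolding avg_def by (simp add: mult.left_commute scaleR_conv_of_real[where 'a = complex])

lemma avg_sum:
  assumes "\<And>i. i \<in> I \<Longrightarrow> integrable (lebesgue_on (cell l)) (f i)"
  shows "avg l (\<lambda>x. \<Sum>i\<in>I. f i x) = (\<Sum>i\<in>I. avg l (f i))"
  unfolding avg_def using assms by (simp add: Bochner_Integration.integral_sum scaleR_sum_right)

lemma avg_of_real: "avg l (\<lambda>x. complex_of_real (g x)) = complex_of_real (avg l g)"
  unfolding avg_def by (simp add: scaleR_conv_of_real[where 'a = complex])

lemma avg_cnj: "avg l (\<lambda>x. cnj (g x)) = cnj (avg l g)"
  unfolding avg_def by simp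

lemma cdot_scaleR_vcnj_sym: "cdot (r *\<^sub>R a) (vcnj b) = cnj (cdot (r *\<^sub>R b) (vcnj a))"
  unfolding cdot_def vcnj_def by (simp add: scaleR_conv_of_real[where 'a = complex] mult_ac)

locale periodic_cell =
  fixes l k :: "real ^ 'n" and \<omega> :: real and G \<rho> :: "real ^ 'n \<Rightarrow> real"
  assumes l_pos: "\<And>j. 0 < l $ j"
    and G: "admissible_coefficient l G"
    and \<rho>: "admissible_coefficient l \<rho>"
begin

abbreviation M :: "(real ^ 'n) measure" where
  "M \<equiv> lebesgue_on (cell l)"

abbreviation kg :: "(real ^ 'n \<Rightarrow> complex) \<Rightarrow> real ^ 'n \<Rightarrow> complex ^ 'n" where
  "kg \<equiv> kgrad l k"

lemma volume_pos: "0 < measure lebesgue (cell l)"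
proof -
  have "(\<chi> j. l $ j / 2) \<in> box 0 l"
    using l_pos by (simp add: mem_box_cart)
  then have "\<not> negligible (box 0 l)"
    using open_not_negligible[OF open_box] by blast
  then have "measure lebesgue (cell l) \<noteq> 0"
    using negligible_iff_measure0[OF cell_lmeasurable[of l]] by (simp add: box_eq_cell)
  then show ?thesis by (simp add: zero_less_measure_iff)
qed

lemma avg_1: "avg l (\<lambda>x. 1 :: complex) = 1"
proof -
  have "measure M (space M) = measure lebesgue (cell l)"
    using measure_restrict_space[of "cell l" lebesgue "cell l"] cell_sets[of l]
    by (simp add: space_restrict_space)
  then show ?thesis
    unfolding avg_def using volume_pos by (simp add: scaleR_conv_of_real[where 'a = complex])
qed

definition form :: "(real ^ 'n \<Rightarrow> complex) \<Rightarrow> (real ^ 'n \<Rightarrow> complex) \<Rightarrow> complex" where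
  "form f g = avg l (\<lambda>x. - complex_of_real (\<omega>\<^sup>2 * \<rho> x) * f x * cnj (g x)) +
     avg l (\<lambda>x. cdot (G x *\<^sub>R kg f x) (vcnj (kg g x)))"

lemma form_hermitian: "form f g = cnj (form g f)"
  unfolding form_def complex_cnj_add avg_cnj[symmetric]
  by (simp add: cdot_scaleR_vcnj_sym[symmetric] mult_ac)

lemma L2_G: "L2 l f \<Longrightarrow> L2 l (\<lambda>x. complex_of_real (G x) * f x)"
  by (rule L2_coefficient[OF G])

lemma L2_\<rho>: "L2 l f \<Longrightarrow> L2 l (\<lambda>x. complex_of_real (\<rho> x) * f x)"
  by (rule L2_coefficient[OF \<rho>])

lemma L2_kg: "H1 l f \<Longrightarrow> L2 l (\<lambda>x. kg f x $ i)"
  by (intro L2_nth kgrad_L2)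

lemma weak_eq_avg:
  assumes "weak_eq l k s F f" "H1_per l \<psi>"
  shows "avg l (\<lambda>x. s x * cnj (\<psi> x)) + avg l (\<lambda>x. cdot (F x) (vcnj (kg \<psi> x)))
    = avg l (\<lambda>x. f x * cnj (\<psi> x))"
  using assms unfolding weak_eq_def avg_def by (simp flip: scaleR_add_right)

lemma form_eq_w:
  assumes "cell_solution_w l k \<omega> G \<rho> w" "H1_per l \<psi>"
  shows "form w \<psi> = avg l (\<lambda>x. cnj (\<psi> x))"
  using weak_eq_avg[of _ _ "\<lambda>x. 1"] assms unfolding cell_solution_w_def form_def by fastforce

text \<open>The part \<open>- mat 1\<close> of the flux moves to the right-hand side, where column
  \<open>j\<close> of the identity singles out component \<open>j\<close> of the test
  gradient.\<close>

lemma form_eq_v: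
  assumes v: "cell_solution_v l k \<omega> G \<rho> v" and \<psi>: "H1_per l \<psi>"
  shows "form (\<lambda>x. v x $ j) \<psi> = avg l (\<lambda>x. complex_of_real (G x) * cnj (kg \<psi> x $ j))"
proof -
  have H1: "H1 l (\<lambda>x. v x $ j)" "H1 l \<psi>"
    using v \<psi> unfolding cell_solution_v_def by (auto intro: H1_per_H1)
  have eq: "cdot (G x *\<^sub>R kg (\<lambda>x. v x $ j) x) (vcnj (kg \<psi> x)) =
      cdot (column j (G x *\<^sub>R (kgrad_vec l k v x - mat 1))) (vcnj (kg \<psi> x))
      + complex_of_real (G x) * cnj (kg \<psi> x $ j)" for x
  proof -
    have "complex_of_real (G x) * cnj (kg \<psi> x $ j)
        = (\<Sum>i\<in>UNIV. complex_of_real (G x) * (if i = j then 1 else 0) * cnj (kg \<psi> x $ i))"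
      by (simp add: if_distrib if_distribR cong: if_cong)
    then show ?thesis
      unfolding cdot_def column_def kgrad_vec_def vcnj_def mat_def
      by (simp add: scaleR_conv_of_real[where 'a = complex] algebra_simps flip: sum.distrib)
  qed
  have "integrable M (\<lambda>x. cdot (G x *\<^sub>R kg (\<lambda>x. v x $ j) x) (vcnj (kg \<psi> x)))"
    unfolding cdot_def vcnj_def
    by (simp add: scaleR_conv_of_real[where 'a = complex])
      (intro Bochner_Integration.integrable_sum L2_mult_integrable L2_G L2_cnj L2_kg H1)
  moreover have int: "integrable M (\<lambda>x. complex_of_real (G x) * cnj (kg \<psi> x $ j))"
    by (intro L2_integrable L2_G L2_cnj L2_kg H1)
  \<comment> \<open>The flux term is integrable as a difference of two integrable functions; this
    allows \<open>avg_add\<close> to split the form.\<close>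
  ultimately have "integrable M (\<lambda>x. cdot (column j (G x *\<^sub>R (kgrad_vec l k v x - mat 1))) (vcnj (kg \<psi> x)))"
    unfolding eq using Bochner_Integration.integrable_diff by fastforce
  then have "form (\<lambda>x. v x $ j) \<psi> = avg l (\<lambda>x. - complex_of_real (\<omega>\<^sup>2 * \<rho> x) * v x $ j * cnj (\<psi> x))
      + avg l (\<lambda>x. cdot (column j (G x *\<^sub>R (kgrad_vec l k v x - mat 1))) (vcnj (kg \<psi> x)))
      + avg l (\<lambda>x. complex_of_real (G x) * cnj (kg \<psi> x $ j))"
    unfolding form_def eq using int by (simp add: avg_add)
  also have "avg l (\<lambda>x. - complex_of_real (\<omega>\<^sup>2 * \<rho> x) * v x $ j * cnj (\<psi> x))
      + avg l (\<lambda>x. cdot (column j (G x *\<^sub>R (kgrad_vec l k v x - mat 1))) (vcnj (kg \<psi> x)))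
      = avg l (\<lambda>x. 0 * cnj (\<psi> x))"
    using v \<psi> unfolding cell_solution_v_def by (intro weak_eq_avg) auto
  finally show ?thesis by (simp add: avg_def)
qed

text \<open>Conjugating the gradient i k of the constant gives - i k, which explains the sign of the
  flux term.\<close>

lemma form_const:
  assumes f: "H1 l f"
  shows "form f (\<lambda>x. 1) = - complex_of_real (\<omega>\<^sup>2) * avg l (\<lambda>x. complex_of_real (\<rho> x) * f x)
    - \<i> * (\<Sum>i\<in>UNIV. complex_of_real (k $ i) * avg l (\<lambda>x. complex_of_real (G x) * kg f x $ i))"
proof -
  have int: "L2 l (\<lambda>x. complex_of_real (G x) * kg f x $ i)" for i
    by (intro L2_G L2_kg f)
  have "avg l (\<lambda>x. cdot (G x *\<^sub>R kg f x) (vcnj (kg (\<lambda>x. 1) x)))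
    = avg l (\<lambda>x. \<Sum>i\<in>UNIV. - \<i> * complex_of_real (k $ i) * (complex_of_real (G x) * kg f x $ i))"
  proof (rule avg_cong_AE)
    show "(\<lambda>x. \<Sum>i\<in>UNIV. - \<i> * complex_of_real (k $ i) * (complex_of_real (G x) * kg f x $ i))
        \<in> borel_measurable M"
      by (intro borel_measurable_sum L2_measurable L2_mult_left int)
    show "(\<lambda>x. cdot (G x *\<^sub>R kg f x) (vcnj (kg (\<lambda>x. 1) x))) \<in> borel_measurable M"
      unfolding cdot_def vcnj_def
      by (simp add: scaleR_conv_of_real[where 'a = complex])
        (intro borel_measurable_sum borel_measurable_times L2_measurable int L2_cnj L2_kg H1_const)
    show "AE x in M. cdot (G x *\<^sub>R kg f x) (vcnj (kg (\<lambda>x. 1) x))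
        = (\<Sum>i\<in>UNIV. - \<i> * complex_of_real (k $ i) * (complex_of_real (G x) * kg f x $ i))"
      using kgrad_const[of l k 1]
      by eventually_elim
        (simp add: cdot_def vcnj_def cvec_def scaleR_conv_of_real[where 'a = complex] mult_ac sum_negf)
  qed
  also have "\<dots> = (\<Sum>i\<in>UNIV. - \<i> * complex_of_real (k $ i) * avg l (\<lambda>x. complex_of_real (G x) * kg f x $ i))"
    unfolding avg_sum[OF L2_integrable[OF L2_mult_left[OF int]]] avg_mult ..
  finally have 1: "avg l (\<lambda>x. cdot (G x *\<^sub>R kg f x) (vcnj (kg (\<lambda>x. 1) x))) =
    - \<i> * (\<Sum>i\<in>UNIV. complex_of_real (k $ i) * avg l (\<lambda>x. complex_of_real (G x) * kg f x $ i))"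
    by (simp add: sum_distrib_left mult.assoc sum_negf)
  have "avg l (\<lambda>x. - complex_of_real (\<omega>\<^sup>2 * \<rho> x) * f x * cnj 1)
    = - complex_of_real (\<omega>\<^sup>2) * avg l (\<lambda>x. complex_of_real (\<rho> x) * f x)"
    unfolding avg_mult[symmetric] by (simp add: mult.assoc)
  then show ?thesis unfolding form_def 1 by simp
qed

end

section \<open>Identities for the two cell functions\<close>

locale willis_cell = periodic_cell l k \<omega> G \<rho>
  for l k :: "real ^ 'n" and \<omega> :: real and G \<rho> :: "real ^ 'n \<Rightarrow> real" +
  fixes w :: "real ^ 'n \<Rightarrow> complex" and v :: "real ^ 'n \<Rightarrow> complex ^ 'n"
  assumes w: "cell_solution_w l k \<omega> G \<rho> w" and v: "cell_solution_v l k \<omega> G \<rho> v"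
begin

abbreviation vc where
  "vc j \<equiv> \<lambda>x. v x $ j"

lemma w_v_per: "H1_per l w" "H1_per l (vc j)"
  using w v by (auto simp: cell_solution_w_def cell_solution_v_def)

lemma w_v_H1: "H1 l w" "H1 l (vc j)"
  using w_v_per H1_per_H1 by blast+

lemma w_v_L2: "L2 l w" "L2 l (vc j)"
  using w_v_H1 H1_L2 by blast+

text \<open>The effective parameters are averages of fields affine in \<open>w\<close> and
  \<open>v\<close>, so they reduce to these scalars together with the averages of \<open>w\<close>,
  \<open>v\<close> and \<open>G\<close>. All symmetries are then relations among finitely many
  numbers.\<close>

definition \<rho>w :: complex where "\<rho>w = avg l (\<lambda>x. complex_of_real (\<rho> x) * w x)"
definition \<rho>v :: "'n \<Rightarrow> complex" where "\<rho>v j = avg l (\<lambda>x. complex_of_real (\<rho> x) * v x $ j)"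
definition Gv :: "'n \<Rightarrow> 'n \<Rightarrow> complex" where
  "Gv i j = avg l (\<lambda>x. complex_of_real (G x) * kg (vc j) x $ i)"

lemma avg_v_nth: "avg l v $ j = avg l (vc j)"
  by (intro avg_vec_nth L2_integrable w_v_L2)

lemma avg_w_real: "cnj (avg l w) = avg l w"
  using form_eq_w[OF w w_v_per(1)] form_hermitian[of w w] by (simp add: avg_cnj)

lemma avg_G_kg_w: "avg l (\<lambda>x. complex_of_real (G x) * kg w x $ j) = cnj (avg l v $ j)"
proof -
  have "cnj (avg l (\<lambda>x. complex_of_real (G x) * kg w x $ j)) = form (vc j) w"
    using form_eq_v[OF v w_v_per(1)] by (simp flip: avg_cnj)
  also have "\<dots> = cnj (form w (vc j))"
    by (rule form_hermitian)
  also have "\<dots> = avg l v $ j"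
    using form_eq_w[OF w w_v_per(2)] by (simp add: avg_cnj avg_v_nth)
  finally show ?thesis by (metis complex_cnj_cnj)
qed

lemma cnj_Gv: "cnj (Gv i j) = Gv j i"
proof -
  have "form (vc i) (vc j) = cnj (Gv i j)" for i j
    using form_eq_v[OF v w_v_per(2)] by (simp add: Gv_def flip: avg_cnj)
  then show ?thesis using form_hermitian by (metis complex_cnj_cnj)
qed

lemma balance_w:
  "1 + complex_of_real (\<omega>\<^sup>2) * \<rho>w = - \<i> * (\<Sum>i\<in>UNIV. complex_of_real (k $ i) * cnj (avg l v $ i))"
proof -
  have "1 = - complex_of_real (\<omega>\<^sup>2) * \<rho>w
      - \<i> * (\<Sum>i\<in>UNIV. complex_of_real (k $ i) * cnj (avg l v $ i))"
    using form_eq_w[OF w H1_per_const[of l 1]] form_const[OF w_v_H1(1)] avg_1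
    by (simp add: \<rho>w_def avg_G_kg_w)
  from arg_cong[OF this, of "\<lambda>z. z + complex_of_real (\<omega>\<^sup>2) * \<rho>w"] show ?thesis
    by simp
qed

lemma balance_v:
  "- complex_of_real (\<omega>\<^sup>2) * \<rho>v j =
    \<i> * (\<Sum>i\<in>UNIV. complex_of_real (k $ i) * Gv i j) - \<i> * complex_of_real (k $ j * avg l G)"
proof -
  have "avg l (\<lambda>x. complex_of_real (G x) * cnj (kg (\<lambda>x. 1) x $ j))
      = avg l (\<lambda>x. - \<i> * complex_of_real (k $ j) * complex_of_real (G x))"
  proof (rule avg_cong_AE)
    show "(\<lambda>x. complex_of_real (G x) * cnj (kg (\<lambda>x. 1) x $ j)) \<in> borel_measurable M"
      by (intro L2_measurable L2_G L2_cnj L2_kg H1_const)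
    show "(\<lambda>x. - \<i> * complex_of_real (k $ j) * complex_of_real (G x)) \<in> borel_measurable M"
      using admissible_coefficient_measurable[OF G] by measurable
    show "AE x in M. complex_of_real (G x) * cnj (kg (\<lambda>x. 1) x $ j)
        = - \<i> * complex_of_real (k $ j) * complex_of_real (G x)"
      using kgrad_const[of l k 1] by eventually_elim (simp add: cvec_def)
  qed
  also have "\<dots> = - \<i> * complex_of_real (k $ j * avg l G)"
    unfolding avg_mult avg_of_real by simp
  finally have "- complex_of_real (\<omega>\<^sup>2) * \<rho>v j - \<i> * (\<Sum>i\<in>UNIV. complex_of_real (k $ i) * Gv i j)
      = - \<i> * complex_of_real (k $ j * avg l G)"
    using form_eq_v[OF v H1_per_const[of l 1], of j] form_const[OF w_v_H1(2), of j]
    by (simp add: \<rho>v_def Gv_def)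
  then show ?thesis by (simp add: algebra_simps)
qed

lemma kgrad_w_v:
  assumes "finite I"
  shows "H1 l (\<lambda>x. a + b * w x + (\<Sum>j\<in>I. c j * v x $ j))"
    and "AE x in M. kg (\<lambda>x. a + b * w x + (\<Sum>j\<in>I. c j * v x $ j)) x =
      (\<i> * a) *s cvec k + b *s kg w x + (\<Sum>j\<in>I. c j *s kg (vc j) x)"
proof -
  note H = H1_const H1_scale H1_add H1_sum assms w_v_H1
  show "H1 l (\<lambda>x. a + b * w x + (\<Sum>j\<in>I. c j * v x $ j))"
    by (intro H)
  have "AE x in M. \<forall>j\<in>I. kg (\<lambda>x. c j * v x $ j) x = c j *s kg (vc j) x"
    using assms kgrad_scale[OF w_v_H1(2)] by (intro AE_finite_allI)
  moreover have "AE x in M. kg (\<lambda>x. \<Sum>j\<in>I. c j * v x $ j) x = (\<Sum>j\<in>I. kg (\<lambda>x. c j * v x $ j) x)"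
    by (intro kgrad_sum H)
  moreover have "AE x in M. kg (\<lambda>x. a + b * w x) x = kg (\<lambda>x. a) x + kg (\<lambda>x. b * w x) x"
    by (intro kgrad_add H)
  moreover have "AE x in M. kg (\<lambda>x. a + b * w x + (\<Sum>j\<in>I. c j * v x $ j)) x
      = kg (\<lambda>x. a + b * w x) x + kg (\<lambda>x. \<Sum>j\<in>I. c j * v x $ j) x"
    by (intro kgrad_add H)
  moreover note kgrad_const[of l k a] kgrad_scale[OF w_v_H1(1), of k b]
  ultimately show "AE x in M. kg (\<lambda>x. a + b * w x + (\<Sum>j\<in>I. c j * v x $ j)) x =
      (\<i> * a) *s cvec k + b *s kg w x + (\<Sum>j\<in>I. c j *s kg (vc j) x)"
    by eventually_elim (simp cong: sum.cong)
qed

lemma avg_G_kgrad_w_v: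
  assumes "finite I"
  shows "avg l (\<lambda>x. complex_of_real (G x) * kg (\<lambda>x. a + b * w x + (\<Sum>j\<in>I. c j * v x $ j)) x $ i)
    = \<i> * a * complex_of_real (k $ i * avg l G) + b * cnj (avg l v $ i) + (\<Sum>j\<in>I. c j * Gv i j)"
proof -
  have L: "L2 l (\<lambda>x. complex_of_real (G x) * kg w x $ i)"
    "L2 l (\<lambda>x. complex_of_real (G x) * kg (vc j) x $ i)" "L2 l (\<lambda>x. complex_of_real (G x))" for j
    using L2_G[OF L2_const[of l 1]] by (auto intro!: L2_G L2_kg w_v_H1)
  let ?g = "\<lambda>x. (\<i> * a * complex_of_real (k $ i)) * complex_of_real (G x) +
      b * (complex_of_real (G x) * kg w x $ i) +
      (\<Sum>j\<in>I. c j * (complex_of_real (G x) * kg (vc j) x $ i))"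
  have int: "integrable M (\<lambda>x. (\<i> * a * complex_of_real (k $ i)) * complex_of_real (G x))"
    "integrable M (\<lambda>x. b * (complex_of_real (G x) * kg w x $ i))"
    "integrable M (\<lambda>x. c j * (complex_of_real (G x) * kg (vc j) x $ i))" for j
    by (intro L2_integrable L2_mult_left L)+
  have "avg l (\<lambda>x. complex_of_real (G x) * kg (\<lambda>x. a + b * w x + (\<Sum>j\<in>I. c j * v x $ j)) x $ i) = avg l ?g"
  proof (rule avg_cong_AE)
    show "(\<lambda>x. complex_of_real (G x) * kg (\<lambda>x. a + b * w x + (\<Sum>j\<in>I. c j * v x $ j)) x $ i) \<in> borel_measurable M"
      by (intro L2_measurable L2_G L2_kg kgrad_w_v assms)
    show "?g \<in> borel_measurable M"
      using int by (intro borel_measurable_add borel_measurable_sum) auto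
    show "AE x in M. complex_of_real (G x) * kg (\<lambda>x. a + b * w x + (\<Sum>j\<in>I. c j * v x $ j)) x $ i = ?g x"
      using kgrad_w_v(2)[OF assms, of a b c]
      by eventually_elim (simp add: cvec_def algebra_simps sum_distrib_left)
  qed
  also have "\<dots> = avg l (\<lambda>x. (\<i> * a * complex_of_real (k $ i)) * complex_of_real (G x)) +
      avg l (\<lambda>x. b * (complex_of_real (G x) * kg w x $ i)) +
      (\<Sum>j\<in>I. avg l (\<lambda>x. c j * (complex_of_real (G x) * kg (vc j) x $ i)))"
    using int by (simp add: avg_add avg_sum Bochner_Integration.integrable_add Bochner_Integration.integrable_sum)
  finally show ?thesis
    unfolding avg_mult avg_G_kg_w avg_of_real Gv_def[symmetric] by simp
qed

end

subsection \<open>Effective parameters\<close>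

context willis_cell
begin

definition kv :: complex where
  "kv = \<i> * cdot (cvec k) (avg l v)"

lemma avg_\<rho>_w_v:
  assumes "finite I"
  shows "avg l (\<lambda>x. complex_of_real (\<rho> x) * (b * w x + (\<Sum>j\<in>I. c j * v x $ j)))
    = b * \<rho>w + (\<Sum>j\<in>I. c j * \<rho>v j)"
proof -
  have "avg l (\<lambda>x. complex_of_real (\<rho> x) * (b * w x + (\<Sum>j\<in>I. c j * v x $ j)))
    = avg l (\<lambda>x. b * (complex_of_real (\<rho> x) * w x) + (\<Sum>j\<in>I. c j * (complex_of_real (\<rho> x) * v x $ j)))"
    by (simp add: distrib_left sum_distrib_left mult.left_commute)
  also have "\<dots> = avg l (\<lambda>x. b * (complex_of_real (\<rho> x) * w x)) +
      (\<Sum>j\<in>I. avg l (\<lambda>x. c j * (complex_of_real (\<rho> x) * v x $ j)))"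
    by (subst avg_add avg_sum,
        (intro Bochner_Integration.integrable_sum L2_integrable L2_mult_left L2_\<rho> w_v_L2)+)+ simp
  finally show ?thesis
    unfolding avg_mult \<rho>w_def \<rho>v_def .
qed

text \<open>The leading 0 and the singleton sum only bring the component into the shape treated by
  \<open>avg_G_kgrad_w_v\<close>.\<close>

lemma A_cell_nth:
  "A_cell l w v x $ j = 0 + avg l v $ j / avg l w * w x + (\<Sum>j\<in>{j}. - 1 * v x $ j)"
  by (simp add: A_cell_def)

text \<open>The i in i k cancels against the prefactor 1 / (i \<omega>), which leaves the real
  coefficients - k / \<omega> in front of the components of \<open>v\<close>.\<close>

lemma B_cell_eq:
  assumes "\<omega> \<noteq> 0" "avg l w \<noteq> 0"
  shows "B_cell l k \<omega> w v x = 1 / (\<i> * complex_of_real \<omega>) + (kv - 1) / (\<i> * complex_of_real \<omega> * avg l w) * w x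
     + (\<Sum>j\<in>UNIV. - complex_of_real (k $ j) / complex_of_real \<omega> * v x $ j)"
proof -
  have sum: "(\<Sum>j\<in>UNIV. - complex_of_real (k $ j) / complex_of_real \<omega> * v x $ j)
      = - cdot (cvec k) (v x) / complex_of_real \<omega>"
    by (simp add: cdot_def cvec_def sum_divide_distrib sum_negf)
  show ?thesis
    unfolding sum using assms by (simp add: B_cell_def kv_def field_simps)
qed

lemma C_eff_nth:
  "C_eff l k G w v $ i $ j
    = complex_of_real (avg l G) * (if i = j then 1 else 0)
      + Z_eff l w * cnj (avg l v $ i) * avg l v $ j - Gv i j"
proof -
  let ?A = "\<lambda>j x. 0 + avg l v $ j / avg l w * w x + (\<Sum>j\<in>{j}. - 1 * v x $ j)"
  let ?f = "\<lambda>i j x. complex_of_real (G x) * kg (?A j) x $ i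
      + (if i = j then 1 else 0) * complex_of_real (G x)"
  have H: "H1 l (?A j)" for j by (rule kgrad_w_v) simp
  have LG: "L2 l (\<lambda>x. complex_of_real (G x))"
    using L2_G[OF L2_const[of l 1]] by simp
  have nth: "(G x *\<^sub>R (kgrad_vec l k (A_cell l w v) x + mat 1)) $ i $ j = ?f i j x" for x i j
    unfolding kgrad_vec_def A_cell_nth
    by (simp add: mat_def scaleR_conv_of_real[where 'a = complex] distrib_left)
  have int: "integrable M (?f i j)" for i j
    by (intro L2_integrable L2_add L2_mult_left LG L2_G L2_kg H)
  \<comment> \<open>An entry of the averaged tensor is extracted in two stages, first the row and
    then the column, each by \<open>avg_vec_nth\<close>.\<close>
  have "C_eff l k G w v $ i = avg l (\<lambda>x. (G x *\<^sub>R (kgrad_vec l k (A_cell l w v) x + mat 1)) $ i)"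
    unfolding C_eff_def by (intro avg_vec_nth integrable_vec) (simp only: nth int)
  also have "\<dots> $ j = avg l (?f i j)"
    by (subst avg_vec_nth) (simp_all only: nth int)
  also have "\<dots> = avg l (\<lambda>x. complex_of_real (G x) * kg (?A j) x $ i)
      + avg l (\<lambda>x. (if i = j then 1 else 0) * complex_of_real (G x))"
    by (intro avg_add L2_integrable L2_mult_left LG L2_G L2_kg H)
  also have "avg l (\<lambda>x. complex_of_real (G x) * kg (?A j) x $ i)
      = avg l v $ j / avg l w * cnj (avg l v $ i) - Gv i j"
    by (subst avg_G_kgrad_w_v) simp_all
  finally show ?thesis
    unfolding avg_mult avg_of_real by (simp add: Z_eff_def)
qed

lemma S2_eff_nth:
  "S2_eff l \<omega> \<rho> w v $ j = \<i> * complex_of_real \<omega> * (\<rho>v j - Z_eff l w * \<rho>w * avg l v $ j)"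
proof -
  let ?A = "\<lambda>j x. avg l v $ j / avg l w * w x + (\<Sum>j\<in>{j}. - 1 * v x $ j)"
  have nth: "((- \<i> * complex_of_real \<omega> * complex_of_real (\<rho> x)) *s A_cell l w v x) $ j
      = (- \<i> * complex_of_real \<omega>) * (complex_of_real (\<rho> x) * ?A j x)" for x j
    using A_cell_nth[of x j] by simp
  have "S2_eff l \<omega> \<rho> w v $ j = avg l (\<lambda>x. (- \<i> * complex_of_real \<omega>) * (complex_of_real (\<rho> x) * ?A j x))"
    unfolding S2_eff_def
    by (subst avg_vec_nth; unfold nth)
      (intro refl L2_integrable L2_mult_left L2_\<rho> L2_add w_v_L2; simp add: L2_mult_left[of _ _ "-1", simplified] w_v_L2)+
  also have "\<dots> = (- \<i> * complex_of_real \<omega>) * (avg l v $ j / avg l w * \<rho>w - \<rho>v j)"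
    unfolding avg_mult by (subst avg_\<rho>_w_v) simp_all
  finally show ?thesis by (simp add: Z_eff_def algebra_simps)
qed

text \<open>Multiplication by i \<omega> clears that factor from the denominators of
  \<open>B_cell\<close>, so that the balance laws can be substituted directly.\<close>

lemma S1_eff_nth:
  assumes "\<omega> \<noteq> 0" "avg l w \<noteq> 0"
  shows "\<i> * complex_of_real \<omega> * S1_eff l k \<omega> G w v $ i
    = \<i> * complex_of_real (k $ i * avg l G) + (kv - 1) * Z_eff l w * cnj (avg l v $ i)
      - \<i> * (\<Sum>j\<in>UNIV. complex_of_real (k $ j) * Gv i j)"
proof -
  let ?a = "1 / (\<i> * complex_of_real \<omega>)" and ?b = "(kv - 1) / (\<i> * complex_of_real \<omega> * avg l w)"
    and ?c = "\<lambda>j. - complex_of_real (k $ j) / complex_of_real \<omega>"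
  let ?B = "\<lambda>x. ?a + ?b * w x + (\<Sum>j\<in>UNIV. ?c j * v x $ j)"
  have B: "B_cell l k \<omega> w v = ?B"
    using B_cell_eq[OF assms] by blast
  have nth: "(G x *\<^sub>R kg ?B x) $ i = complex_of_real (G x) * kg ?B x $ i" for x i
    by (simp add: scaleR_conv_of_real[where 'a = complex])
  have int: "integrable M (\<lambda>x. complex_of_real (G x) * kg ?B x $ i)" for i
    by (intro L2_integrable L2_G L2_kg kgrad_w_v finite)
  have "S1_eff l k \<omega> G w v $ i = avg l (\<lambda>x. complex_of_real (G x) * kg ?B x $ i)"
    unfolding S1_eff_def B by (subst avg_vec_nth) (simp_all only: nth int)
  also have "\<dots> = \<i> * ?a * complex_of_real (k $ i * avg l G) + ?b * cnj (avg l v $ i)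
      + (\<Sum>j\<in>UNIV. ?c j * Gv i j)"
    by (rule avg_G_kgrad_w_v) simp
  also have "(\<Sum>j\<in>UNIV. ?c j * Gv i j)
      = - (\<Sum>j\<in>UNIV. complex_of_real (k $ j) * Gv i j) / complex_of_real \<omega>"
    by (simp add: sum_divide_distrib sum_negf)
  finally have eq: "S1_eff l k \<omega> G w v $ i = \<i> * ?a * complex_of_real (k $ i * avg l G)
      + ?b * cnj (avg l v $ i)
      + - (\<Sum>j\<in>UNIV. complex_of_real (k $ j) * Gv i j) / complex_of_real \<omega>" .
  show ?thesis
    unfolding eq using assms by (simp add: Z_eff_def field_simps)
qed

lemma cnj_kv: "cnj kv = 1 + complex_of_real (\<omega>\<^sup>2) * \<rho>w"
  unfolding balance_w by (simp add: kv_def cdot_def cvec_def)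

text \<open>This is the conjugated balance law for \<open>w\<close>. The factor
  \<open>kv - 1\<close> occurs in both \<open>rho_eff\<close> and \<open>S1_eff\<close>; here it
  becomes a multiple of \<open>cnj \<rho>w\<close>, which yields the squared modulus in the first
  and the match with \<open>S2_eff\<close> in the second.\<close>

lemma kv_eq: "kv - 1 = complex_of_real (\<omega>\<^sup>2) * cnj \<rho>w"
  using arg_cong[OF cnj_kv, of cnj] by simp

text \<open>The constant 1 / (i \<omega>) in \<open>B_cell\<close> cancels the leading \<rho>, so
  the average of \<rho> alone disappears and only weighted averages of \<open>w\<close> and
  \<open>v\<close> remain.\<close>

lemma rho_eff_eq:
  assumes "\<omega> \<noteq> 0" "avg l w \<noteq> 0"
  shows "rho_eff l k \<omega> \<rho> w v = - complex_of_real (\<omega>\<^sup>2) * Z_eff l w * complex_of_real ((cmod \<rho>w)\<^sup>2)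
    + \<i> * (\<Sum>j\<in>UNIV. complex_of_real (k $ j) * \<rho>v j)"
proof -
  have "complex_of_real (\<rho> x) - \<i> * complex_of_real \<omega> * complex_of_real (\<rho> x) * B_cell l k \<omega> w v x
      = complex_of_real (\<rho> x) * ((1 - kv) * Z_eff l w * w x + (\<Sum>j\<in>UNIV. \<i> * complex_of_real (k $ j) * v x $ j))" for x
  proof -
    have "\<i> * complex_of_real \<omega> * B_cell l k \<omega> w v x
      = 1 - ((1 - kv) * Z_eff l w * w x + \<i> * cdot (cvec k) (v x))"
      using assms by (simp add: B_cell_def kv_def Z_eff_def field_simps)
    moreover have "\<i> * cdot (cvec k) (v x) = (\<Sum>j\<in>UNIV. \<i> * complex_of_real (k $ j) * v x $ j)"
      by (simp add: cdot_def cvec_def sum_distrib_left mult.assoc)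
    moreover have "complex_of_real (\<rho> x) - \<i> * complex_of_real \<omega> * complex_of_real (\<rho> x) * B_cell l k \<omega> w v x
      = complex_of_real (\<rho> x) * (1 - \<i> * complex_of_real \<omega> * B_cell l k \<omega> w v x)"
      by (simp add: algebra_simps)
    ultimately show ?thesis by simp
  qed
  then have "rho_eff l k \<omega> \<rho> w v = (1 - kv) * Z_eff l w * \<rho>w + (\<Sum>j\<in>UNIV. \<i> * complex_of_real (k $ j) * \<rho>v j)"
    unfolding rho_eff_def by (simp only: avg_\<rho>_w_v finite)
  moreover have "1 - kv = - complex_of_real (\<omega>\<^sup>2) * cnj \<rho>w"
    using kv_eq by (simp add: algebra_simps)
  ultimately show ?thesis
    by (simp add: sum_distrib_left mult.assoc complex_norm_square mult_ac del: of_real_power)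
qed

text \<open>By \<open>balance_v\<close>, - \<omega>^2 times this number is |k|^2 times the average
  of \<open>G\<close>, minus the quadratic form of the Hermitian matrix \<open>Gv\<close> at the
  real vector \<open>k\<close>. Both are real, and the real factor can be cancelled.\<close>

lemma k_\<rho>v_real:
  assumes "\<omega> \<noteq> 0"
  shows "cnj (\<i> * (\<Sum>j\<in>UNIV. complex_of_real (k $ j) * \<rho>v j))
    = \<i> * (\<Sum>j\<in>UNIV. complex_of_real (k $ j) * \<rho>v j)"
proof -
  let ?s = "\<i> * (\<Sum>j\<in>UNIV. complex_of_real (k $ j) * \<rho>v j)"
  let ?q = "\<Sum>j\<in>UNIV. \<Sum>i\<in>UNIV. complex_of_real (k $ j) * complex_of_real (k $ i) * Gv i j"
  let ?g = "\<Sum>j\<in>UNIV. complex_of_real (k $ j * (k $ j * avg l G))"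
  have "- complex_of_real (\<omega>\<^sup>2) * ?s
      = \<i> * (\<Sum>j\<in>UNIV. complex_of_real (k $ j) * (- complex_of_real (\<omega>\<^sup>2) * \<rho>v j))"
    by (simp add: sum_distrib_left mult_ac sum_negf)
  also have "\<dots> = ?g - ?q"
    unfolding balance_v
    by (simp add: sum_distrib_left right_diff_distrib sum_subtractf mult_ac sum_negf)
  finally have eq: "- complex_of_real (\<omega>\<^sup>2) * ?s = ?g - ?q" .
  have "cnj ?q = (\<Sum>j\<in>UNIV. \<Sum>i\<in>UNIV. complex_of_real (k $ j) * complex_of_real (k $ i) * Gv j i)"
    by (simp add: cnj_Gv)
  also have "\<dots> = ?q"
    by (subst sum.swap) (simp add: mult_ac)
  finally have real: "cnj (- complex_of_real (\<omega>\<^sup>2) * ?s) = - complex_of_real (\<omega>\<^sup>2) * ?s"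
    unfolding eq by simp
  have cancel: "cnj z = z" if "cnj (- complex_of_real r * z) = - complex_of_real r * z" "r \<noteq> 0" for r z
    using that by simp
  show ?thesis
    by (rule cancel[OF real]) (use assms in simp)
qed

lemma Z_eff_real: "cnj (Z_eff l w) = Z_eff l w"
  by (simp add: Z_eff_def avg_w_real)

lemma avg_\<rho>_v: "avg l (\<lambda>x. \<rho> x *\<^sub>R v x) $ j = \<rho>v j"
  unfolding \<rho>v_def
  by (subst avg_vec_nth)
    (simp_all add: scaleR_conv_of_real[where 'a = complex] L2_integrable L2_\<rho> w_v_L2)

lemma avg_G_kgrad_v: "avg l (\<lambda>x. G x *\<^sub>R kgrad_vec l k v x) $ i $ j = Gv i j"
proof -
  have nth: "(G x *\<^sub>R kgrad_vec l k v x) $ i $ j = complex_of_real (G x) * kg (vc j) x $ i" for x i j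
    by (simp add: kgrad_vec_def scaleR_conv_of_real[where 'a = complex])
  have int: "integrable M (\<lambda>x. complex_of_real (G x) * kg (vc j) x $ i)" for i j
    by (intro L2_integrable L2_G L2_kg w_v_H1)
  have "avg l (\<lambda>x. G x *\<^sub>R kgrad_vec l k v x) $ i = avg l (\<lambda>x. (G x *\<^sub>R kgrad_vec l k v x) $ i)"
    by (intro avg_vec_nth integrable_vec) (simp only: nth int)
  also have "\<dots> $ j = Gv i j"
    unfolding Gv_def by (subst avg_vec_nth) (simp_all only: nth int)
  finally show ?thesis .
qed

lemma rho_eff_real:
  assumes "\<omega> \<noteq> 0" "avg l w \<noteq> 0"
  shows "rho_eff l k \<omega> \<rho> w v = cnj (rho_eff l k \<omega> \<rho> w v)"
  unfolding rho_eff_eq[OF assms] complex_cnj_add k_\<rho>v_real[OF assms(1)]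
  by (simp add: Z_eff_real)

lemma C_eff_hermitian: "C_eff l k G w v = conj_transpose (C_eff l k G w v)"
  by (simp add: vec_eq_iff conj_transpose_def C_eff_nth Z_eff_real cnj_Gv)

text \<open>Conjugating \<open>balance_v\<close> and using that \<open>Gv\<close> is Hermitian turns
  its sum over the first index into the sum over the second index in \<open>S1_eff_nth\<close>. The
  two sides are compared after multiplication by i \<omega>.\<close>

lemma S_eff_adjoint:
  assumes "\<omega> \<noteq> 0" "avg l w \<noteq> 0"
  shows "S1_eff l k \<omega> G w v = - vcnj (S2_eff l \<omega> \<rho> w v)"
proof -
  have "S1_eff l k \<omega> G w v $ i = - cnj (S2_eff l \<omega> \<rho> w v $ i)" for i
  proof -
    have "- complex_of_real (\<omega>\<^sup>2) * cnj (\<rho>v i)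
        = - \<i> * (\<Sum>j\<in>UNIV. complex_of_real (k $ j) * Gv i j) + \<i> * complex_of_real (k $ i * avg l G)"
      using arg_cong[OF balance_v[of i], of cnj] by (simp add: cnj_Gv)
    then have "\<i> * complex_of_real \<omega> * S1_eff l k \<omega> G w v $ i
        = complex_of_real (\<omega>\<^sup>2) * (Z_eff l w * cnj \<rho>w * cnj (avg l v $ i) - cnj (\<rho>v i))"
      unfolding S1_eff_nth[OF assms] kv_eq by (simp add: algebra_simps)
    also have "\<dots> = \<i> * complex_of_real \<omega> * (- cnj (S2_eff l \<omega> \<rho> w v $ i))"
      unfolding S2_eff_nth by (simp add: Z_eff_real power2_eq_square algebra_simps)
    finally have "\<i> * complex_of_real \<omega> * S1_eff l k \<omega> G w v $ i
        = \<i> * complex_of_real \<omega> * (- cnj (S2_eff l \<omega> \<rho> w v $ i))" .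
    moreover have "\<i> * complex_of_real \<omega> \<noteq> 0" using assms(1) by simp
    ultimately show ?thesis by (rule mult_left_cancel[THEN iffD1, rotated])
  qed
  then show ?thesis by (simp add: vec_eq_iff vcnj_def)
qed

end

subsection \<open>Eigenfunction expansions\<close>

lemma L2_weighted_if_L2:
  fixes f :: "real ^ 'n \<Rightarrow> 'b::real_normed_vector"
  assumes g: "admissible_coefficient l g" and f: "L2 l f"
  shows "L2_weighted l g f"
proof -
  obtain K where K: "AE x in lebesgue_on (cell l). \<bar>g x\<bar> \<le> K"
    using admissible_coefficient_bounded[OF g] by blast
  have "integrable (lebesgue_on (cell l)) (\<lambda>x. g x * (norm (f x))\<^sup>2)"
  proof (rule Bochner_Integration.integrable_bound)
    show "integrable (lebesgue_on (cell l)) (\<lambda>x. K * (norm (f x))\<^sup>2)"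
      using f by (simp add: L2_iff)
    show "(\<lambda>x. g x * (norm (f x))\<^sup>2) \<in> borel_measurable (lebesgue_on (cell l))"
      using admissible_coefficient_measurable[OF g] L2_measurable[OF f] by measurable
    show "AE x in lebesgue_on (cell l). norm (g x * (norm (f x))\<^sup>2) \<le> norm (K * (norm (f x))\<^sup>2)"
      using K by eventually_elim (auto simp: abs_mult intro!: mult_right_mono)
  qed
  then show ?thesis using L2_measurable[OF f] by (simp add: L2_weighted_def)
qed

section \<open>The weighted inner product\<close>

context periodic_cell
begin

text \<open>An integral and not an average, to match the normalisation in
  \<open>eigensystem\<close>; the volume of the cell therefore enters when \<open>ip\<close> is
  compared with \<open>form\<close>.\<close>

definition ip :: "(real ^ 'n \<Rightarrow> complex) \<Rightarrow> (real ^ 'n \<Rightarrow> complex) \<Rightarrow> complex" where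
  "ip f g = (LINT x|M. complex_of_real (\<rho> x) * f x * cnj (g x))"

lemma ip_integrable:
  "L2 l f \<Longrightarrow> L2 l g \<Longrightarrow> integrable M (\<lambda>x. complex_of_real (\<rho> x) * f x * cnj (g x))"
  by (intro L2_mult_integrable L2_\<rho> L2_cnj)

lemma ip_add_left: "L2 l f \<Longrightarrow> L2 l g \<Longrightarrow> L2 l h \<Longrightarrow> ip (\<lambda>x. f x + g x) h = ip f h + ip g h"
  unfolding ip_def distrib_left distrib_right
  by (intro Bochner_Integration.integral_add ip_integrable)

lemma ip_mult_left: "ip (\<lambda>x. c * f x) g = c * ip f g"
  unfolding ip_def by (simp add: mult.left_commute mult.assoc)

lemma ip_cnj: "cnj (ip f g) = ip g f"
  unfolding ip_def Bochner_Integration.integral_cnj[symmetric]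
  by (simp add: mult_ac del: Bochner_Integration.integral_cnj)

lemma L2_sum:
  fixes f :: "nat \<Rightarrow> real ^ 'n \<Rightarrow> complex"
  assumes "finite I" "\<And>i. i \<in> I \<Longrightarrow> L2 l (f i)"
  shows "L2 l (\<lambda>x. \<Sum>i\<in>I. f i x)"
  using assms by (induction I rule: finite_induct) (auto intro: L2_const L2_add)

lemma ip_sum_left:
  fixes f :: "nat \<Rightarrow> real ^ 'n \<Rightarrow> complex"
  assumes "finite I" "\<And>i. i \<in> I \<Longrightarrow> L2 l (f i)" "L2 l g"
  shows "ip (\<lambda>x. \<Sum>i\<in>I. f i x) g = (\<Sum>i\<in>I. ip (f i) g)"
  using assms
proof (induction I rule: finite_induct)
  case empty
  then show ?case by (simp add: ip_def)
next
  case (insert i I)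
  then show ?case by (simp add: ip_add_left L2_sum)
qed

definition sqnorm :: "(real ^ 'n \<Rightarrow> complex) \<Rightarrow> real" where
  "sqnorm f = (LINT x|M. \<rho> x * (norm (f x))\<^sup>2)"

lemma sqnorm_nonneg: "0 \<le> sqnorm f"
  unfolding sqnorm_def
  by (rule integral_nonneg_AE) (use admissible_coefficient_nonneg[OF \<rho>] in \<open>auto elim!: eventually_mono\<close>)

lemma ip_self: "ip f f = complex_of_real (sqnorm f)"
  unfolding ip_def sqnorm_def integral_complex_of_real[symmetric] of_real_mult complex_norm_square
  by (simp only: mult.assoc)

text \<open>Pythagoras, with the nonnegative contribution of \<open>g\<close> dropped.\<close>

lemma sqnorm_add_orthogonal:
  assumes f: "L2 l f" and g: "L2 l g" and orth: "ip g f = 0"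
  shows "sqnorm f \<le> sqnorm (\<lambda>x. f x + g x)"
proof -
  note fg = L2_add[OF f g]
  have "ip f g = 0" using orth ip_cnj by (metis complex_cnj_zero)
  \<comment> \<open>Additivity is available in the left argument; conjugate symmetry transfers it to
    the right one.\<close>
  have "ip (\<lambda>x. f x + g x) (\<lambda>x. f x + g x) = cnj (ip (\<lambda>x. f x + g x) f) + cnj (ip (\<lambda>x. f x + g x) g)"
    using ip_add_left[OF f g fg] by (simp add: ip_cnj)
  also have "\<dots> = ip f f + ip g g"
    using orth \<open>ip f g = 0\<close> by (simp add: ip_add_left f g ip_cnj)
  finally have "complex_of_real (sqnorm (\<lambda>x. f x + g x)) = complex_of_real (sqnorm f + sqnorm g)"
    by (simp add: ip_self)
  then show ?thesis using sqnorm_nonneg[of g] by (simp only: of_real_eq_iff)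
qed

end

locale periodic_eigensystem = periodic_cell l k \<omega> G \<rho>
  for l k :: "real ^ 'n" and \<omega> :: real and G \<rho> :: "real ^ 'n \<Rightarrow> real" +
  fixes \<phi> :: "nat \<Rightarrow> real ^ 'n \<Rightarrow> complex" and ev :: "nat \<Rightarrow> real"
  assumes eig: "eigensystem l k G \<rho> \<phi> ev"
begin

lemma \<phi>_per: "1 \<le> m \<Longrightarrow> H1_per l (\<phi> m)"
  using eig by (simp add: eigensystem_def)

lemma \<phi>_L2: "1 \<le> m \<Longrightarrow> L2 l (\<phi> m)"
  using \<phi>_per H1_per_H1 H1_L2 by blast

lemma \<phi>_orthonormal: "1 \<le> m \<Longrightarrow> 1 \<le> n \<Longrightarrow> ip (\<phi> m) (\<phi> n) = (if m = n then 1 else 0)"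
  using eig by (simp add: eigensystem_def ip_def)

lemma form_eq_\<phi>:
  assumes m: "1 \<le> m" and \<psi>: "H1_per l \<psi>"
  shows "form (\<phi> m) \<psi> =
    complex_of_real (ev m - \<omega>\<^sup>2) * avg l (\<lambda>x. complex_of_real (\<rho> x) * \<phi> m x * cnj (\<psi> x))"
proof -
  have "avg l (\<lambda>x. 0 * cnj (\<psi> x)) + avg l (\<lambda>x. cdot (G x *\<^sub>R kg (\<phi> m) x) (vcnj (kg \<psi> x)))
      = avg l (\<lambda>x. complex_of_real (ev m * \<rho> x) * \<phi> m x * cnj (\<psi> x))"
    using eig m by (intro weak_eq_avg[OF _ \<psi>]) (simp add: eigensystem_def)
  moreover have "avg l (\<lambda>x. 0 * cnj (\<psi> x)) = 0" by (simp add: avg_def)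
  ultimately have "form (\<phi> m) \<psi> =
      avg l (\<lambda>x. - complex_of_real (\<omega>\<^sup>2) * (complex_of_real (\<rho> x) * \<phi> m x * cnj (\<psi> x))) +
      avg l (\<lambda>x. complex_of_real (ev m) * (complex_of_real (\<rho> x) * \<phi> m x * cnj (\<psi> x)))"
    unfolding form_def by (simp add: mult.assoc)
  then show ?thesis unfolding avg_mult by (simp add: algebra_simps)
qed

text \<open>Hermitian symmetry lets the eigenvalue equation be tested with \<open>u\<close>, so the
  form is the real number \<open>ev m - \<omega>\<^sup>2\<close> times the averaged Fourier
  coefficient. Non-resonance allows division, and the volume undoes the averaging.\<close>

lemma coefficient_eq_form:
  assumes m: "1 \<le> m" and nonres: "\<omega>\<^sup>2 \<noteq> ev m" and u: "H1_per l u"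
  shows "ip u (\<phi> m) = complex_of_real (measure lebesgue (cell l)) * form u (\<phi> m) / complex_of_real (ev m - \<omega>\<^sup>2)"
proof -
  have "form u (\<phi> m) = cnj (form (\<phi> m) u)"
    by (rule form_hermitian)
  also have "\<dots> = complex_of_real (ev m - \<omega>\<^sup>2) * avg l (\<lambda>x. complex_of_real (\<rho> x) * u x * cnj (\<phi> m x))"
    unfolding form_eq_\<phi>[OF m u] complex_cnj_mult avg_cnj[symmetric] by (simp add: mult_ac)
  finally have "form u (\<phi> m) = complex_of_real (ev m - \<omega>\<^sup>2) * ip u (\<phi> m)
      / complex_of_real (measure lebesgue (cell l))"
    by (simp add: avg_def ip_def scaleR_conv_of_real[where 'a = complex])
  moreover have "complex_of_real (ev m - \<omega>\<^sup>2) \<noteq> 0"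
    using nonres by (simp only: of_real_eq_0_iff)
  ultimately show ?thesis
    using volume_pos by (simp add: field_simps del: of_real_diff)
qed

text \<open>Completeness supplies a single good finite combination. Every later Fourier partial sum
  is an orthogonal projection onto a larger span, hence at least as good.\<close>

lemma fourier_series_converges:
  assumes f: "L2 l f"
  shows "converges_L2_weighted l \<rho> (\<lambda>N x. \<Sum>m = 1..N. ip f (\<phi> m) * \<phi> m x) f"
proof -
  define F where "F N = (\<lambda>x. \<Sum>m = 1..N. ip f (\<phi> m) * \<phi> m x)" for N
  have LF: "L2 l (F N)" for N
    unfolding F_def by (intro L2_sum L2_mult_left \<phi>_L2) auto
  have orth: "ip (\<lambda>x. f x - F N x) (\<phi> m) = 0" if "m \<in> {1..N}" for m N
  proof -
    have "ip (F N) (\<phi> m) = (\<Sum>n = 1..N. ip (\<lambda>x. ip f (\<phi> n) * \<phi> n x) (\<phi> m))"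
      unfolding F_def using that by (intro ip_sum_left L2_mult_left \<phi>_L2) auto
    also have "\<dots> = (\<Sum>n = 1..N. if n = m then ip f (\<phi> m) else 0)"
      unfolding ip_mult_left using that by (intro sum.cong) (auto simp: \<phi>_orthonormal)
    also have "\<dots> = ip f (\<phi> m)" using that by simp
    finally show ?thesis
      using ip_add_left[OF f L2_mult_left[OF LF, of "-1"], of "\<phi> m"] \<phi>_L2[of m] that
        ip_mult_left[of "-1" "F N" "\<phi> m"] by simp
  qed
  have best: "sqnorm (\<lambda>x. f x - F N x) \<le> sqnorm (\<lambda>x. f x - (\<Sum>m = 1..n. c m * \<phi> m x))"
    if "n \<le> N" for n N c
  proof -
    \<comment> \<open>The competitor has length \<open>n\<close> and the partial sum length
      \<open>N\<close>; padding \<open>c\<close> with zeros makes their difference a combination of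
      the first \<open>N\<close> eigenfunctions, orthogonal to the Fourier remainder.\<close>
    define e where "e m = ip f (\<phi> m) - (if m \<le> n then c m else 0)" for m
    define H where "H = (\<lambda>x. \<Sum>m = 1..N. e m * \<phi> m x)"
    have LH: "L2 l H"
      unfolding H_def by (intro L2_sum L2_mult_left \<phi>_L2) auto
    have LfF: "L2 l (\<lambda>x. f x - F N x)"
      by (intro L2_diff f LF)
    have "ip (\<phi> m) (\<lambda>x. f x - F N x) = 0" if "m \<in> {1..N}" for m
      using orth[OF that] ip_cnj by (metis complex_cnj_zero)
    then have "ip H (\<lambda>x. f x - F N x) = 0"
      unfolding H_def
      by (subst ip_sum_left) (auto simp: ip_mult_left intro!: L2_mult_left \<phi>_L2 LfF)
    then have "sqnorm (\<lambda>x. f x - F N x) \<le> sqnorm (\<lambda>x. f x - F N x + H x)"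
      by (intro sqnorm_add_orthogonal LfF LH)
    moreover have "f x - F N x + H x = f x - (\<Sum>m = 1..n. c m * \<phi> m x)" for x
    proof -
      have "(\<Sum>m = 1..N. (if m \<le> n then c m else 0) * \<phi> m x) = (\<Sum>m = 1..n. c m * \<phi> m x)"
        using that by (intro sum.mono_neutral_cong_right) auto
      then show ?thesis
        unfolding F_def H_def e_def left_diff_distrib sum_subtractf by simp
    qed
    ultimately show ?thesis by simp
  qed
  have "(\<lambda>N. sqnorm (\<lambda>x. f x - F N x)) \<longlonglongrightarrow> 0"
  proof (rule LIMSEQ_I)
    fix r :: real assume "0 < r"
    then obtain n c where "sqnorm (\<lambda>x. f x - (\<Sum>m = 1..n. c m * \<phi> m x)) < r"
      using eig L2_weighted_if_L2[OF \<rho> f] unfolding eigensystem_def sqnorm_def by blast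
    then have "norm (sqnorm (\<lambda>x. f x - F N x) - 0) < r" if "n \<le> N" for N
      using best[OF that, of c] sqnorm_nonneg by (simp add: order_le_less_trans)
    then show "\<exists>n. \<forall>N\<ge>n. norm (sqnorm (\<lambda>x. f x - F N x) - 0) < r" by blast
  qed
  moreover have "L2_weighted l \<rho> (\<lambda>x. F N x - f x)" for N
    by (intro L2_weighted_if_L2[OF \<rho>] L2_diff LF f)
  ultimately show ?thesis
    unfolding converges_L2_weighted_def sqnorm_def F_def by (simp add: norm_minus_commute)
qed

end

lemma converges_L2_weighted_vec:
  fixes F :: "nat \<Rightarrow> real ^ 'n \<Rightarrow> complex ^ 'm"
  assumes "\<And>j. converges_L2_weighted l g (\<lambda>N x. F N x $ j) (\<lambda>x. f x $ j)"
  shows "converges_L2_weighted l g F f"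
proof -
  have meas: "(\<lambda>x. F N x - f x) \<in> borel_measurable (lebesgue_on (cell l))" for N
    using assms by (intro measurable_vec) (simp add: converges_L2_weighted_def L2_weighted_def)
  have int: "integrable (lebesgue_on (cell l)) (\<lambda>x. g x * (norm (F N x $ j - f x $ j))\<^sup>2)" for N j
    using assms by (simp add: converges_L2_weighted_def L2_weighted_def)
  have lim: "(\<lambda>N. LINT x|lebesgue_on (cell l). g x * (norm (F N x $ j - f x $ j))\<^sup>2) \<longlonglongrightarrow> 0" for j
    using assms by (simp add: converges_L2_weighted_def)
  have "(\<lambda>N. \<Sum>j\<in>UNIV. LINT x|lebesgue_on (cell l). g x * (norm (F N x $ j - f x $ j))\<^sup>2)
      \<longlonglongrightarrow> (\<Sum>j\<in>(UNIV :: 'm set). 0)"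
    by (intro tendsto_sum lim)
  then show ?thesis
    unfolding converges_L2_weighted_def L2_weighted_def norm_vec_power2 sum_distrib_left vector_minus_component
    using meas int by (simp add: Bochner_Integration.integral_sum)
qed

locale willis_eigensystem = willis_cell l k \<omega> G \<rho> w v + periodic_eigensystem l k \<omega> G \<rho> \<phi> ev
  for l k :: "real ^ 'n" and \<omega> :: real and G \<rho> :: "real ^ 'n \<Rightarrow> real" and w v \<phi> ev +
  assumes nonres: "\<And>m. 1 \<le> m \<Longrightarrow> \<omega>\<^sup>2 \<noteq> ev m"
begin

lemma w_series:
  "converges_L2_weighted l \<rho>
     (\<lambda>N x. \<Sum>m = 1..N. (LINT y|M. cnj (\<phi> m y)) / complex_of_real (ev m - \<omega>\<^sup>2) * \<phi> m x) w"
proof -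
  have "ip w (\<phi> m) = (LINT y|M. cnj (\<phi> m y)) / complex_of_real (ev m - \<omega>\<^sup>2)" if "1 \<le> m" for m
    using that coefficient_eq_form[OF _ nonres w_v_per(1), of m] form_eq_w[OF w \<phi>_per, of m] volume_pos
    by (simp add: avg_def scaleR_conv_of_real[where 'a = complex])
  then have "(\<lambda>N x. \<Sum>m = 1..N. ip w (\<phi> m) * \<phi> m x) =
      (\<lambda>N x. \<Sum>m = 1..N. (LINT y|M. cnj (\<phi> m y)) / complex_of_real (ev m - \<omega>\<^sup>2) * \<phi> m x)"
    by (intro ext sum.cong refl) (simp only: atLeastAtMost_iff)
  with fourier_series_converges[OF w_v_L2(1)] show ?thesis by (simp only:)
qed

lemma v_series:
  "converges_L2_weighted l \<rho>
     (\<lambda>N x. \<Sum>m = 1..N. (\<phi> m x / complex_of_real (ev m - \<omega>\<^sup>2)) *s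
        (LINT y|M. G y *\<^sub>R vcnj (kg (\<phi> m) y))) v"
proof (rule converges_L2_weighted_vec)
  fix j
  have "ip (vc j) (\<phi> m) * \<phi> m x =
      ((\<phi> m x / complex_of_real (ev m - \<omega>\<^sup>2)) *s (LINT y|M. G y *\<^sub>R vcnj (kg (\<phi> m) y))) $ j"
    if m: "1 \<le> m" for m x
  proof -
    have "(LINT y|M. G y *\<^sub>R vcnj (kg (\<phi> m) y)) $ j = (LINT y|M. (G y *\<^sub>R vcnj (kg (\<phi> m) y)) $ j)"
    proof (rule integral_vec_nth)
      show "integrable M (\<lambda>y. (G y *\<^sub>R vcnj (kg (\<phi> m) y)) $ i)" for i
        by (simp add: vcnj_def scaleR_conv_of_real[where 'a = complex])
          (intro L2_integrable L2_G L2_cnj L2_kg H1_per_H1 \<phi>_per m)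
    qed
    then show ?thesis
      using coefficient_eq_form[OF m nonres[OF m] w_v_per(2), of j] form_eq_v[OF v \<phi>_per[OF m], of j] volume_pos
      by (simp add: avg_def vcnj_def scaleR_conv_of_real[where 'a = complex])
  qed
  then have "(\<lambda>N x. \<Sum>m = 1..N. ip (vc j) (\<phi> m) * \<phi> m x) =
      (\<lambda>N x. (\<Sum>m = 1..N. (\<phi> m x / complex_of_real (ev m - \<omega>\<^sup>2)) *s
        (LINT y|M. G y *\<^sub>R vcnj (kg (\<phi> m) y))) $ j)"
    unfolding sum_component by (intro ext sum.cong refl) (simp only: atLeastAtMost_iff)
  with fourier_series_converges[OF w_v_L2(2)[of j]]
  show "converges_L2_weighted l \<rho>
     (\<lambda>N x. (\<Sum>m = 1..N. (\<phi> m x / complex_of_real (ev m - \<omega>\<^sup>2)) *s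
        (LINT y|M. G y *\<^sub>R vcnj (kg (\<phi> m) y))) $ j) (vc j)"
    by (simp only:)
qed

end

theorem proposition1:
  fixes l k :: "real ^ 'n::finite"
    and \<omega> :: real
    and G \<rho> :: "real ^ 'n \<Rightarrow> real"
    and w :: "real ^ 'n \<Rightarrow> complex"
    and v :: "real ^ 'n \<Rightarrow> complex ^ 'n"
    and \<phi> :: "nat \<Rightarrow> real ^ 'n \<Rightarrow> complex"
    and ev :: "nat \<Rightarrow> real"
  assumes dim: "CARD('n) \<in> {1, 2, 3}"
    and l_pos: "\<And>j. 0 < l $ j"
    and G: "admissible_coefficient l G"
    and \<rho>: "admissible_coefficient l \<rho>"
    and w: "cell_solution_w l k \<omega> G \<rho> w"
    and v: "cell_solution_v l k \<omega> G \<rho> v"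
    and eig: "eigensystem l k G \<rho> \<phi> ev"
    and omega: "\<omega> \<noteq> 0"
    and nonres: "\<And>m. m \<ge> 1 \<Longrightarrow> \<omega>\<^sup>2 \<noteq> ev m"
    and w_avg: "avg l w \<noteq> 0"
  shows
    "rho_eff l k \<omega> \<rho> w v = cnj (rho_eff l k \<omega> \<rho> w v) \<and>
     C_eff l k G w v = conj_transpose (C_eff l k G w v) \<and>
     S1_eff l k \<omega> G w v = - vcnj (S2_eff l \<omega> \<rho> w v) \<and>
     rho_eff l k \<omega> \<rho> w v =
       - complex_of_real (\<omega>\<^sup>2) * Z_eff l w *
           complex_of_real ((cmod (avg l (\<lambda>x. complex_of_real (\<rho> x) * w x)))\<^sup>2)
       + \<i> * cdot (cvec k) (avg l (\<lambda>x. \<rho> x *\<^sub>R v x)) \<and>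
     C_eff l k G w v =
       avg l G *\<^sub>R mat 1 + (\<chi> i j. Z_eff l w * outer (vcnj (avg l v)) (avg l v) $ i $ j)
       - avg l (\<lambda>x. G x *\<^sub>R kgrad_vec l k v x) \<and>
     S2_eff l \<omega> \<rho> w v =
       (\<i> * complex_of_real \<omega>) *s
         (avg l (\<lambda>x. \<rho> x *\<^sub>R v x)
          - (Z_eff l w * avg l (\<lambda>x. complex_of_real (\<rho> x) * w x)) *s avg l v) \<and>
     converges_L2_weighted l \<rho>
       (\<lambda>N x. \<Sum>m = 1..N.
          (LINT y|lebesgue_on (cell l). cnj (\<phi> m y)) / complex_of_real (ev m - \<omega>\<^sup>2) * \<phi> m x)
       w \<and>
     converges_L2_weighted l \<rho>
       (\<lambda>N x. \<Sum>m = 1..N.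
          (\<phi> m x / complex_of_real (ev m - \<omega>\<^sup>2)) *s
            (LINT y|lebesgue_on (cell l). G y *\<^sub>R vcnj (kgrad l k (\<phi> m) y)))
       v"
proof -
  interpret willis_eigensystem l k \<omega> G \<rho> w v \<phi> ev
    using l_pos G \<rho> w v eig nonres by unfold_locales auto
  have "rho_eff l k \<omega> \<rho> w v =
       - complex_of_real (\<omega>\<^sup>2) * Z_eff l w *
           complex_of_real ((cmod (avg l (\<lambda>x. complex_of_real (\<rho> x) * w x)))\<^sup>2)
       + \<i> * cdot (cvec k) (avg l (\<lambda>x. \<rho> x *\<^sub>R v x))"
    unfolding rho_eff_eq[OF omega w_avg] by (simp add: \<rho>w_def cdot_def cvec_def avg_\<rho>_v)
  moreover have "C_eff l k G w v =
       avg l G *\<^sub>R mat 1 + (\<chi> i j. Z_eff l w * outer (vcnj (avg l v)) (avg l v) $ i $ j)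
       - avg l (\<lambda>x. G x *\<^sub>R kgrad_vec l k v x)"
    by (simp add: vec_eq_iff C_eff_nth avg_G_kgrad_v outer_def vcnj_def mat_def
        scaleR_conv_of_real[where 'a = complex])
  moreover have "S2_eff l \<omega> \<rho> w v =
       (\<i> * complex_of_real \<omega>) *s
         (avg l (\<lambda>x. \<rho> x *\<^sub>R v x)
          - (Z_eff l w * avg l (\<lambda>x. complex_of_real (\<rho> x) * w x)) *s avg l v)"
    by (simp add: vec_eq_iff S2_eff_nth avg_\<rho>_v \<rho>w_def algebra_simps)
  ultimately show ?thesis
    using rho_eff_real[OF omega w_avg] C_eff_hermitian S_eff_adjoint[OF omega w_avg]
      w_series v_series
    by blast
qed

end
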